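(* For every integer $i\geqslant 1$ there exists a Turing transducer $T\in\mathcal{T}$ whose Følner function $f_n$, $n=1,2,\dots$, is defined and satisfies $f_n\sim n^{(n^i)}$.
   Context: **Class $\mathcal{T}$.** A $(k+1)$-tape Turing transducer ($k\geqslant 1$) is a deterministic multi-tape Turing machine with one input tape and $k$ output tapes. The class $\mathcal{T}$ consists of those $(k+1)$-tape Turing transducers $T$ (for any $k\geqslant 1$ and any finite input alphabet $\Sigma$) that work as follows on every input $x\in\Sigma^*$. Initially $x$ is on the input tape, the output tapes are completely blank, and all heads are over the leftmost cells. First all heads move synchronously from left to right until the end of the input $x$; then they make a finite number (possibly zero) of further steps to the right, this number being bounded above by a constant depending only on $T$; after that all heads move synchronously from right to left until $T$ enters a final state with all heads over the leftmost cells. $T$ accepts $x$ if this final state is accepting, otherwise it rejects $x$. Let $L\subseteq\Sigma^*$ be the set of inputs accepted by $T$. For $x\in L$, $T$ translates $x$ into the outputs $y_1,\dots,y_k$ if, on input $x$, $T$ halts with the word $y_i$ on the $i$th output tape for $i=1,\dots,k$. It is required that $y_i\in L$ for all $x\in L$ and all $i$. **Følner function of $T$.** For $w\in L$ let $T(w)=\{w_1,\dots,w_k\}$ be the set of outputs of $T$ on $w$. For a finite set $W\subseteq L$ put $\partial W=\{w\in W\mid T(w)\not\subseteq W\}$. Put $\mathrm{F{\o}l}(\varepsilon)=\min\{\#W\mid W\subseteq L \text{ finite},\ \#\partial W<\varepsilon\,\#W\}$; it is assumed (required) that the set of such $W$ is nonempty for every $\varepsilon\in(0,1)$. The Følner function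 of $T$ is the sequence $f_n=\mathrm{F{\o}l}(1/n)$, $n=1,2,\dots$. **Equivalence.** Here $f_1(n)\sim f_2(n)$ means that there exists $K\in\mathbb{N}$, $K\geqslant 1$, such that $f_1(Kn)\geqslant\frac1K f_2(n)$ and $f_2(Kn)\geqslant\frac1K f_1(n)$ for all $n\geqslant 1$. *)

theory Defs
  imports Complex_Main
begin

datatype move = MoveL | Stay | MoveR

text \<open>
  Tapes are one-way infinite with cells indexed by \<^typ>\<open>nat\<close>; a left move on the leftmost
  cell \<open>0\<close> leaves the head where it is.
\<close>

fun move_head :: "move \<Rightarrow> nat \<Rightarrow> nat" where
  "move_head MoveL h = h - 1"
| "move_head Stay h = h"
| "move_head MoveR h = Suc h"

record ('q, 'a) transducer =
  states :: "'q set"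
  input_alphabet :: "'a set"
  tape_alphabet :: "'a set"
  blank :: 'a
  num_outputs :: nat
  start :: 'q
  final :: "'q set"
  accepting :: "'q set"
  delta :: "'q \<Rightarrow> 'a list \<Rightarrow> 'q \<times> ('a \<times> move) list"

definition is_transducer :: "('q, 'a) transducer \<Rightarrow> bool" where
  "is_transducer T \<longleftrightarrow>
     num_outputs T \<ge> 1 \<and>
     finite (states T) \<and> finite (tape_alphabet T) \<and>
     blank T \<in> tape_alphabet T \<and>
     input_alphabet T \<subseteq> tape_alphabet T - {blank T} \<and>
     start T \<in> states T \<and> final T \<subseteq> states T \<and> accepting T \<subseteq> final T \<and>
     (\<forall>q \<in> states T - final T. \<forall>as q' acts.
        length as = num_outputs T + 1 \<longrightarrow> set as \<subseteq> tape_alphabet T \<longrightarrow>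
        delta T q as = (q', acts) \<longrightarrow>
          q' \<in> states T \<and> length acts = num_outputs T + 1 \<and>
          fst ` set acts \<subseteq> tape_alphabet T)"

text \<open>
  A configuration is a state with a list of pairs (tape contents, head position).
  Tape \<open>0\<close> is the input tape, tapes \<open>1, \<dots>, k\<close> are the output tapes.
\<close>

type_synonym ('q, 'a) config = "'q \<times> ((nat \<Rightarrow> 'a) \<times> nat) list"

definition word_tape :: "'a \<Rightarrow> 'a list \<Rightarrow> nat \<Rightarrow> 'a" where
  "word_tape b w = (\<lambda>j. if j < length w then w ! j else b)"

definition init_config :: "('q, 'a) transducer \<Rightarrow> 'a list \<Rightarrow> ('q, 'a) config" where
  "init_config T x =
     (start T, (word_tape (blank T) x, 0) # replicate (num_outputs T) (\<lambda>_. blank T, 0))"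

definition step :: "('q, 'a) transducer \<Rightarrow> ('q, 'a) config \<Rightarrow> ('q, 'a) config" where
  "step T c =
     (let (q, tapes) = c;
          (q', acts) = delta T q (map (\<lambda>(t, h). t h) tapes)
      in (q', map2 (\<lambda>(t, h) (a, d). (t(h := a), move_head d h)) tapes acts))"

text \<open>
  Iterates of \<^const>\<open>step\<close> are meaningful only up to the first final state; halting is
  taken care of in \<open>halts_at\<close>.
\<close>

definition config_at :: "('q, 'a) transducer \<Rightarrow> 'a list \<Rightarrow> nat \<Rightarrow> ('q, 'a) config" where
  "config_at T x t = (step T ^^ t) (init_config T x)"

definition halts_at :: "('q, 'a) transducer \<Rightarrow> 'a list \<Rightarrow> nat \<Rightarrow> bool" where
  "halts_at T x N \<longleftrightarrow>
     fst (config_at T x N) \<in> final T \<and> (\<forall>t<N. fst (config_at T x t) \<notin> final T)"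

definition language :: "('q, 'a) transducer \<Rightarrow> 'a list set" where
  "language T =
     {x \<in> lists (input_alphabet T). \<exists>N. halts_at T x N \<and> fst (config_at T x N) \<in> accepting T}"

definition translates :: "('q, 'a) transducer \<Rightarrow> 'a list \<Rightarrow> 'a list list \<Rightarrow> bool" where
  "translates T x ys \<longleftrightarrow>
     x \<in> language T \<and> length ys = num_outputs T \<and> set ys \<subseteq> lists (input_alphabet T) \<and>
     (\<exists>N. halts_at T x N \<and>
        (\<forall>i<num_outputs T. fst (snd (config_at T x N) ! Suc i) = word_tape (blank T) (ys ! i)))"

text \<open>
  The heads turn around at cell \<open>m\<close>, that is, \<open>m - length x\<close> cells after the first cell
  behind the input (a machine without end markers cannot recognise the end of the input
  earlier), and are back over the leftmost cells at time \<open>2 * m\<close>. The final state is entered either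
  on arrival there or by the step performed there, hence the two values of \<open>N\<close>; in the
  latter case the truncated difference \<open>2 * m - N\<close> is \<open>0\<close>.
\<close>

definition sweeps :: "('q, 'a) transducer \<Rightarrow> nat \<Rightarrow> 'a list \<Rightarrow> bool" where
  "sweeps T C x \<longleftrightarrow>
     (\<exists>m N. length x \<le> m \<and> m \<le> length x + C \<and>
        (N = 2 * m \<or> N = 2 * m + 1) \<and> halts_at T x N \<and>
        (\<forall>t\<le>N. \<forall>(tape, h) \<in> set (snd (config_at T x t)).
            h = (if t \<le> m then t else 2 * m - t)))"

definition class_T :: "('q, 'a) transducer set" where
  "class_T =
     {T. is_transducer T \<and>
         (\<exists>C. \<forall>x \<in> lists (input_alphabet T). sweeps T C x) \<and>
         (\<forall>x \<in> language T. \<exists>ys. translates T x ys \<and> set ys \<subseteq> language T)}"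

definition outputs :: "('q, 'a) transducer \<Rightarrow> 'a list \<Rightarrow> 'a list set" where
  "outputs T w = {y. \<exists>ys. translates T w ys \<and> y \<in> set ys}"

definition boundary :: "('q, 'a) transducer \<Rightarrow> 'a list set \<Rightarrow> 'a list set" where
  "boundary T W = {w \<in> W. \<not> outputs T w \<subseteq> W}"

definition folner_sets :: "('q, 'a) transducer \<Rightarrow> real \<Rightarrow> 'a list set set" where
  "folner_sets T \<epsilon> =
     {W. finite W \<and> W \<subseteq> language T \<and> real (card (boundary T W)) < \<epsilon> * real (card W)}"

definition folner_defined :: "('q, 'a) transducer \<Rightarrow> bool" where
  "folner_defined T \<longleftrightarrow> (\<forall>\<epsilon>. 0 < \<epsilon> \<and> \<epsilon> < 1 \<longrightarrow> folner_sets T \<epsilon> \<noteq> {})"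

definition Fol :: "('q, 'a) transducer \<Rightarrow> real \<Rightarrow> nat" where
  "Fol T \<epsilon> = (LEAST n. \<exists>W \<in> folner_sets T \<epsilon>. n = card W)"

definition folner_function :: "('q, 'a) transducer \<Rightarrow> nat \<Rightarrow> nat" where
  "folner_function T n = Fol T (1 / real n)"

definition growth_equiv :: "(nat \<Rightarrow> nat) \<Rightarrow> (nat \<Rightarrow> nat) \<Rightarrow> bool" where
  "growth_equiv f g \<longleftrightarrow>
     (\<exists>K::nat. K \<ge> 1 \<and>
        (\<forall>n\<ge>1. real (f (K * n)) \<ge> 1 / real K * real (g n) \<and>
                real (g (K * n)) \<ge> 1 / real K * real (f n)))"

end

theory Submission
  imports Defs "HOL-Library.Countable" "HOL-Library.FuncSet"
begin

text \<open>
  The transducer imitates the wreath product of \<open>\<int>\<close> with \<open>\<int>\<^sup>i\<close>. A word is a sequence of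
  blocks. A block stores \<open>i\<close> binary counters, each with a fixed target, and also a lamp counter, which is
  governed by the neighbouring block. For \<open>1 \<le> j \<le> i\<close>, output \<open>j\<close> decrements the \<open>j\<close>-th
  counter in all blocks at once. So the cursor of the wreath product is not a mark in the word: every
  block knows its own displacement from the cursor. Output \<open>0\<close> decrements the lamps of those
  blocks whose counters equal their targets. If a counter underflows or no block is at its target, the
  word is declared dead; on dead words the outputs append distinct letters, so dead words form a free, and hence
  expanding, part. This makes malformed words harmless.

  Lower bound: the orbit of a point of \<open>W\<close> under any output leaves \<open>W\<close> through the boundary, so
  there are at most as many lines as boundary points. If the boundary is small, then one can delete
  all lines with fewer than \<open>n\<close> points, repeatedly, without exhausting \<open>W\<close>. In what
  remains every line has at least \<open>n\<close> points. A finite set of functions that has, at every point,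
  \<open>q\<close> coordinate lines with \<open>r\<close> points has at least \<open>r ^ q\<close> elements. Applied to cursor
  positions this gives \<open>n ^ i\<close> positions for every lamp configuration, and applied to lamp
  configurations it gives \<open>n ^ (n ^ i)\<close> of them.

  Upper bound: take a power of two \<open>M\<close> of order \<open>n\<close>, one block for each target in
  \<open>{0..<M} ^ i\<close>, equal counters in all blocks and arbitrary lamps below \<open>M\<close>.
\<close>

section \<open>Thick lines\<close>

lemma finite_line:
  assumes "finite F"
  shows "finite {v. f(x := v) \<in> F}"
proof -
  have "inj (\<lambda>v. f(x := v))" by (auto intro!: injI dest: fun_upd_eqD)
  with assms have "finite ((\<lambda>v. f(x := v)) -` F)" by (rule finite_vimageI)
  then show ?thesis by (simp add: vimage_def)
qed

text \<open>Induction on \<open>q\<close>: one thick direction \<open>x\<close> at one point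
  \<open>f\<close> gives at least \<open>r\<close> disjoint nonempty slices \<open>g x = v\<close>.
  Lines in directions other than \<open>x\<close> stay inside a slice, so each point of a slice
  keeps at least \<open>q\<close> thick directions. The directions may vary from point to
  point.\<close>

lemma card_ge_power_of_thick_lines:
  fixes F :: "('x \<Rightarrow> 'v) set"
  assumes "finite F" "F \<noteq> {}"
    and "\<And>f. f \<in> F \<Longrightarrow> \<exists>X. finite X \<and> q \<le> card X \<and> (\<forall>x\<in>X. r \<le> card {v. f(x := v) \<in> F})"
  shows "r ^ q \<le> card F"
  using assms
proof (induction q arbitrary: F)
  case 0
  then show ?case by (simp add: Suc_le_eq card_gt_0_iff)
next
  case (Suc q)
  obtain f where f: "f \<in> F" using Suc.prems by blast
  obtain X where X: "finite X" "Suc q \<le> card X" "\<forall>x\<in>X. r \<le> card {v. f(x := v) \<in> F}"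
    using Suc.prems(3)[OF f] by blast
  then obtain x where x: "x \<in> X" by fastforce
  define S where "S = {v. f(x := v) \<in> F}"
  define G where "G v = {g \<in> F. g x = v}" for v
  have finS: "finite S" using Suc.prems(1) finite_line by (simp add: S_def)
  have G: "r ^ q \<le> card (G v)" if v: "v \<in> S" for v
  proof (rule Suc.IH)
    show "finite (G v)" using Suc.prems by (simp add: G_def)
    have "f(x := v) \<in> G v" using v by (simp add: G_def S_def)
    then show "G v \<noteq> {}" by blast
    fix g assume g: "g \<in> G v"
    then obtain Y where Y: "finite Y" "Suc q \<le> card Y" "\<forall>y\<in>Y. r \<le> card {u. g(y := u) \<in> F}"
      using Suc.prems(3)[of g] unfolding G_def by blast
    have "{u. g(y := u) \<in> G v} = {u. g(y := u) \<in> F}" if "y \<noteq> x" for y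
      using that g by (auto simp: G_def)
    then show "\<exists>X. finite X \<and> q \<le> card X \<and> (\<forall>y\<in>X. r \<le> card {u. g(y := u) \<in> G v})"
      using Y by (intro exI[of _ "Y - {x}"]) (auto simp: card_Diff_singleton_if)
  qed
  have "r ^ Suc q \<le> card S * r ^ q"
    using X(3) x by (simp add: S_def)
  also have "\<dots> \<le> (\<Sum>v\<in>S. card (G v))"
    using sum_mono[of S "\<lambda>_. r ^ q"] G by simp
  also have "\<dots> = card (\<Union>v\<in>S. G v)"
    using Suc.prems finS by (intro card_UN_disjoint[symmetric]) (auto simp: G_def)
  also have "\<dots> \<le> card F"
    using Suc.prems by (intro card_mono) (auto simp: G_def)
  finally show ?case .
qed

text \<open>Fibres with fewer than \<open>n\<close> points are deleted one at a time. A deletion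
  costs fewer than \<open>n\<close> points of \<open>V\<close> but removes a value of some
  \<open>p j\<close>, so the strict inequality survives and the set never becomes empty.\<close>

lemma exists_subset_with_thick_fibres:
  fixes p :: "'j \<Rightarrow> 'w \<Rightarrow> 'e"
  assumes "finite V" "finite J" "n * (\<Sum>j\<in>J. card (p j ` V)) < card V"
  shows "\<exists>U\<subseteq>V. U \<noteq> {} \<and> (\<forall>j\<in>J. \<forall>w\<in>U. n \<le> card {v \<in> U. p j v = p j w})"
  using assms
proof (induction "card V" arbitrary: V rule: less_induct)
  case less
  show ?case
  proof (cases "\<forall>j\<in>J. \<forall>w\<in>V. n \<le> card {v \<in> V. p j v = p j w}")
    case True
    with less.prems show ?thesis by (intro exI[of _ V]) auto
  next
    case False
    then obtain j w where jw: "j \<in> J" "w \<in> V" "card {v \<in> V. p j v = p j w} < n"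
      by (auto simp: not_le)
    define R where "R = {v \<in> V. p j v = p j w}"
    have R: "R \<subseteq> V" "w \<in> R" "card R < n" "finite R" using jw less.prems by (auto simp: R_def)
    have cV: "card V = card (V - R) + card R"
      using R less.prems by (simp add: card_Diff_subset card_mono)
    have "0 < card R" using R by (auto simp: card_gt_0_iff)
    have mono: "card (p l ` (V - R)) \<le> card (p l ` V)" for l
      using less.prems by (intro card_mono) auto
    have "p j w \<in> p j ` V" "p j w \<notin> p j ` (V - R)"
      using jw by (auto simp: R_def)
    then have "p j ` (V - R) \<subset> p j ` V" by blast
    then have "card (p j ` (V - R)) < card (p j ` V)"
      using less.prems by (intro psubset_card_mono) auto
    then have "(\<Sum>l\<in>J. card (p l ` (V - R))) < (\<Sum>l\<in>J. card (p l ` V))"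
      using jw mono less.prems by (intro sum_strict_mono_ex1) auto
    then have "n * Suc (\<Sum>l\<in>J. card (p l ` (V - R))) \<le> n * (\<Sum>l\<in>J. card (p l ` V))"
      by (intro mult_le_mono2) simp
    then have "n * (\<Sum>l\<in>J. card (p l ` (V - R))) < card (V - R)"
      using less.prems(3) cV R(3) by simp
    then obtain U where "U \<subseteq> V - R" "U \<noteq> {}"
        "\<forall>j\<in>J. \<forall>w\<in>U. n \<le> card {v \<in> U. p j v = p j w}"
      using less.hyps[of "V - R"] cV \<open>0 < card R\<close> less.prems by auto
    then show ?thesis by blast
  qed
qed

text \<open>The map \<open>p\<close> sends a point to the first point outside \<open>I\<close> on
  its orbit under \<open>g\<close>, which exists because \<open>pot\<close> falls. As
  \<open>g\<close> is injective on \<open>I\<close>, points with the same end lie on one orbit,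
  where \<open>h\<close> is constant and \<open>pot\<close> separates points.\<close>

lemma exists_line_endpoint_map:
  fixes g :: "'w \<Rightarrow> 'w" and pot :: "'w \<Rightarrow> nat"
  assumes I: "I \<subseteq> V" "\<And>w. w \<in> I \<Longrightarrow> g w \<in> V" "inj_on g I"
    and pot: "\<And>w. w \<in> I \<Longrightarrow> pot (g w) < pot w"
    and h: "\<And>w. w \<in> I \<Longrightarrow> h (g w) = h w"
  shows "\<exists>p. p ` V \<subseteq> V - I \<and>
    (\<forall>v\<in>V. \<forall>w\<in>V. p v = p w \<longrightarrow> h v = h w \<and> (pot v = pot w \<longrightarrow> v = w))"
proof -
  define r where "r = {(w, g w) | w. w \<in> I}"
  have ex: "\<exists>e. e \<in> V - I \<and> (w, e) \<in> r\<^sup>*" if "w \<in> V" for w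
    using that
  proof (induction "pot w" arbitrary: w rule: less_induct)
    case less
    show ?case
    proof (cases "w \<in> I")
      case True
      then obtain e where "e \<in> V - I" "(g w, e) \<in> r\<^sup>*"
        using less pot I(2) by blast
      moreover have "(w, g w) \<in> r" using True by (auto simp: r_def)
      ultimately show ?thesis by (meson converse_rtrancl_into_rtrancl)
    qed (use less in blast)
  qed
  then obtain p where p: "\<And>w. w \<in> V \<Longrightarrow> p w \<in> V - I \<and> (w, p w) \<in> r\<^sup>*" by metis
  have along: "h w = h v \<and> (w = v \<or> pot w < pot v)" if "(v, w) \<in> r\<^sup>*" for v w
    using that
  proof (induction rule: rtrancl_induct)
    case (step y z)
    then have "h z = h y" "pot z < pot y" using pot h by (auto simp: r_def)
    with step show ?case by auto
  qed simp
  \<comment> \<open>Backward steps are unique, so two backward paths from a common end are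
    comparable.\<close>
  have sv: "single_valued (r\<inverse>)"
    using I(3) by (auto simp: single_valued_def r_def inj_on_def)
  have "h v = h w \<and> (pot v = pot w \<longrightarrow> v = w)" if "v \<in> V" "w \<in> V" "p v = p w" for v w
  proof -
    have "(p v, v) \<in> (r\<inverse>)\<^sup>*" "(p v, w) \<in> (r\<inverse>)\<^sup>*"
      using p[OF that(1)] p[OF that(2)] that(3) by (simp_all add: rtrancl_converse)
    from single_valued_confluent[OF sv this] have "(v, w) \<in> r\<^sup>* \<or> (w, v) \<in> r\<^sup>*"
      by (auto simp: rtrancl_converse)
    then show ?thesis using along by fastforce
  qed
  with p show ?thesis by (intro exI[of _ p]) blast
qed

text \<open>Here \<open>\<kappa>\<close> is the cursor position, \<open>c\<close> the lamp
  configuration, and \<open>V - I\<close> contains the ends of all lines. After thinning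
  \<open>V\<close> until every line has \<open>n\<close> points, functions are counted twice: first
  positions, then lamps.\<close>

lemma card_ge_power_power:
  fixes g :: "nat \<Rightarrow> 'w \<Rightarrow> 'w" and \<kappa> :: "'w \<Rightarrow> nat \<Rightarrow> int" and c :: "'w \<Rightarrow> (nat \<Rightarrow> int) \<Rightarrow> nat"
  assumes fin: "finite V" and I: "I \<subseteq> V"
    and g: "\<And>j w. j \<le> i \<Longrightarrow> w \<in> I \<Longrightarrow> g j w \<in> V" "\<And>j. inj_on (g j) I"
    and nonneg: "\<And>w j. 0 \<le> \<kappa> w j"
    and move: "\<And>j w. 1 \<le> j \<Longrightarrow> j \<le> i \<Longrightarrow> w \<in> I \<Longrightarrow> \<kappa> (g j w) = (\<kappa> w)(j := \<kappa> w j - 1)"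
      "\<And>j w. 1 \<le> j \<Longrightarrow> j \<le> i \<Longrightarrow> w \<in> I \<Longrightarrow> c (g j w) = c w"
    and lamp: "\<And>w. w \<in> I \<Longrightarrow> \<kappa> (g 0 w) = \<kappa> w"
      "\<And>w x. w \<in> I \<Longrightarrow> x \<noteq> \<kappa> w \<Longrightarrow> c (g 0 w) x = c w x"
      "\<And>w. w \<in> I \<Longrightarrow> c (g 0 w) (\<kappa> w) < c w (\<kappa> w)"
    and small: "n * (Suc i * card (V - I)) < card V"
  shows "n ^ (n ^ i) \<le> card V"
proof -
  \<comment> \<open>\<open>pot j\<close> is the coordinate lowered by operation \<open>j\<close>,
    for \<open>j = 0\<close> the lamp under the cursor; \<open>inv j\<close> is what the operation
    preserves.\<close>
  define pot where "pot j w = (if j = 0 then c w (\<kappa> w) else nat (\<kappa> w j))" for j w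
  define inv where "inv j w = (if j = 0 then (\<kappa> w, (c w)(\<kappa> w := 0)) else ((\<kappa> w)(j := 0), c w))" for j w
  define Q where "Q j p \<longleftrightarrow> p ` V \<subseteq> V - I \<and> (\<forall>v\<in>V. \<forall>w\<in>V. p v = p w \<longrightarrow>
      inv j v = inv j w \<and> (pot j v = pot j w \<longrightarrow> v = w))" for j p
  have "\<exists>p. Q j p" if j: "j \<le> i" for j
    unfolding Q_def
  proof (rule exists_line_endpoint_map[where g = "g j"])
    fix w assume w: "w \<in> I"
    show "g j w \<in> V" using g j w by simp
    show "pot j (g j w) < pot j w"
    proof (cases "j = 0")
      case True
      then show ?thesis using lamp w by (simp add: pot_def)
    next
      case False
      then have "\<kappa> (g j w) j = \<kappa> w j - 1" using move j w by simp
      with nonneg[of "g j w" j] show ?thesis using False by (simp add: pot_def)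
    qed
    show "inv j (g j w) = inv j w"
    proof (cases "j = 0")
      case True
      then show ?thesis using lamp w by (auto simp: inv_def)
    next
      case False
      then show ?thesis using move j w by (auto simp: inv_def)
    qed
  qed (use I g in auto)
  then obtain p where "\<And>j. j \<le> i \<Longrightarrow> Q j (p j)" by metis
  then have p: "\<And>j. j \<le> i \<Longrightarrow> p j ` V \<subseteq> V - I"
      "\<And>j v w. j \<le> i \<Longrightarrow> v \<in> V \<Longrightarrow> w \<in> V \<Longrightarrow> p j v = p j w \<Longrightarrow> inv j v = inv j w"
      "\<And>j v w. j \<le> i \<Longrightarrow> v \<in> V \<Longrightarrow> w \<in> V \<Longrightarrow> p j v = p j w \<Longrightarrow> pot j v = pot j w \<Longrightarrow> v = w"
    unfolding Q_def by blast+
  \<comment> \<open>Every endpoint map takes values in \<open>V - I\<close>, which bounds the number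
    of lines.\<close>
  have "(\<Sum>j\<in>{..i}. card (p j ` V)) \<le> (\<Sum>j\<in>{..i}. card (V - I))"
    using p(1) fin by (intro sum_mono card_mono) auto
  then have "n * (\<Sum>j\<in>{..i}. card (p j ` V)) \<le> n * (Suc i * card (V - I))"
    by (intro mult_le_mono2) simp
  with small have "n * (\<Sum>j\<in>{..i}. card (p j ` V)) < card V" by linarith
  from exists_subset_with_thick_fibres[OF fin _ this]
  obtain U where U: "U \<subseteq> V" "U \<noteq> {}"
      "\<And>j w. j \<le> i \<Longrightarrow> w \<in> U \<Longrightarrow> n \<le> card {v \<in> U. p j v = p j w}"
    by (metis atMost_iff finite_atMost)
  have finU: "finite U" using U fin finite_subset by blast
  have thick: "n \<le> card (pot j ` {v \<in> U. p j v = p j w})" if "j \<le> i" "w \<in> U" for j w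
  proof -
    have "inj_on (pot j) {v \<in> U. p j v = p j w}"
      using p(3)[OF that(1)] U(1) by (auto simp: inj_on_def) (metis subsetD)
    then show ?thesis using U(3)[OF that] by (simp add: card_image)
  qed
  \<comment> \<open>The positions that occur in \<open>U\<close> together with the lamps
    \<open>f\<close>; they become the thick directions at \<open>f\<close>.\<close>
  define K where "K f = \<kappa> ` {w \<in> U. c w = f}" for f
  have K: "n ^ i \<le> card (K (c w0))" if w0: "w0 \<in> U" for w0
  proof (rule card_ge_power_of_thick_lines)
    show "finite (K (c w0))" using finU by (simp add: K_def)
    show "K (c w0) \<noteq> {}" using w0 by (auto simp: K_def)
    fix f assume "f \<in> K (c w0)"
    then obtain w where w: "w \<in> U" "c w = c w0" "f = \<kappa> w" by (auto simp: K_def)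
    have "n \<le> card {v. f(j := v) \<in> K (c w0)}" if j: "1 \<le> j" "j \<le> i" for j
    proof -
      let ?L = "{v \<in> U. p j v = p j w}"
      have "(\<lambda>v. \<kappa> v j) ` ?L \<subseteq> {v. f(j := v) \<in> K (c w0)}"
      proof clarify
        fix v assume v: "v \<in> U" "p j v = p j w"
        then have "inv j v = inv j w" using p(2) j w U(1) by blast
        then have e: "(\<kappa> v)(j := 0) = (\<kappa> w)(j := 0)" "c v = c w" using j by (simp_all add: inv_def)
        have "f(j := \<kappa> v j) = ((\<kappa> w)(j := 0))(j := \<kappa> v j)" using w by simp
        also have "\<dots> = \<kappa> v" unfolding e(1)[symmetric] by simp
        finally show "f(j := \<kappa> v j) \<in> K (c w0)" using v e w by (auto simp: K_def)
      qed
      moreover have "finite {v. f(j := v) \<in> K (c w0)}"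
        using finU by (intro finite_line) (simp add: K_def)
      \<comment> \<open>\<open>nat\<close> can only merge values, so the bound for
        \<open>pot j\<close> passes to the integer coordinate.\<close>
      moreover have "card (nat ` (\<lambda>v. \<kappa> v j) ` ?L) \<le> card ((\<lambda>v. \<kappa> v j) ` ?L)"
        using finU by (intro card_image_le) simp
      moreover have "pot j ` ?L = nat ` (\<lambda>v. \<kappa> v j) ` ?L" using j by (auto simp: pot_def)
      ultimately have "card (pot j ` ?L) \<le> card {v. f(j := v) \<in> K (c w0)}"
        by (metis (no_types, lifting) card_mono le_trans)
      with thick[OF j(2) w(1)] show ?thesis by linarith
    qed
    then show "\<exists>X. finite X \<and> i \<le> card X \<and> (\<forall>x\<in>X. n \<le> card {v. f(x := v) \<in> K (c w0)})"
      by (intro exI[of _ "{1..i}"]) auto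
  qed
  have "n ^ (n ^ i) \<le> card (c ` U)"
  proof (rule card_ge_power_of_thick_lines)
    fix f assume "f \<in> c ` U"
    then obtain w0 where w0: "w0 \<in> U" "f = c w0" by blast
    have "n \<le> card {v. f(x := v) \<in> c ` U}" if x: "x \<in> K f" for x
    proof -
      obtain w where w: "w \<in> U" "c w = f" "x = \<kappa> w" using x by (auto simp: K_def)
      let ?L = "{v \<in> U. p 0 v = p 0 w}"
      have "pot 0 ` ?L \<subseteq> {v. f(x := v) \<in> c ` U}"
      proof clarify
        fix v assume v: "v \<in> U" "p 0 v = p 0 w"
        then have "inv 0 v = inv 0 w" using p(2) w U(1) by blast
        then have e: "(c v)(x := 0) = f(x := 0)" "\<kappa> v = x" using w by (auto simp: inv_def)
        have "f(x := pot 0 v) = (f(x := 0))(x := c v x)" using e by (simp add: pot_def)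
        also have "\<dots> = c v" unfolding e(1)[symmetric] by simp
        finally show "f(x := pot 0 v) \<in> c ` U" using v by simp
      qed
      moreover have "finite {v. f(x := v) \<in> c ` U}"
        using finU by (intro finite_line) simp
      ultimately have "card (pot 0 ` ?L) \<le> card {v. f(x := v) \<in> c ` U}"
        by (rule card_mono[rotated])
      with thick[of 0 w] w(1) show ?thesis by simp
    qed
    moreover have "finite (K f)" "n ^ i \<le> card (K f)" using K w0 finU by (auto simp: K_def)
    ultimately show "\<exists>X. finite X \<and> n ^ i \<le> card X \<and> (\<forall>x\<in>X. n \<le> card {v. f(x := v) \<in> c ` U})"
      by blast
  qed (use finU U in auto)
  also have "\<dots> \<le> card U" using finU by (rule card_image_le)
  also have "\<dots> \<le> card V" using U fin by (simp add: card_mono)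
  finally show ?thesis .
qed

section \<open>Counter words\<close>

text \<open>
  A live word is \<^term>\<open>Live\<close> followed by digits and separators; it is read from right to left, so
  the scanned list is the reverse of the tail. A digit \<open>Dig l x t\<close> is the next more significant bit \<open>x\<close>
  of counter \<open>l\<close> of the current block and bit \<open>t\<close> of its target; counter \<open>0\<close> is the lamp.
\<close>

datatype sym = Blank | Mark | Live | Dead nat | Sep | Dig nat bool bool

instance sym :: countable
  by countable_datatype

type_synonym scan = "bool \<times> bool \<times> bool \<times> bool"

text \<open>
  In a scan state \<open>(m, c, f, g)\<close>, \<open>m\<close> says that the current block has agreed with its targets so
  far (always true for \<open>j \<noteq> 0\<close>), \<open>c\<close> is the pending borrow, \<open>f\<close> says that some earlier
  block was at its target (true from the start for \<open>j \<noteq> 0\<close>), and \<open>g\<close> that no underflow has occurred. For \<open>j = 0\<close> the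
  lamp of a block is controlled by the previously scanned block, because the machine knows only at the
  separator whether a block is at its target.
\<close>

fun scan_step :: "nat \<Rightarrow> scan \<Rightarrow> sym \<Rightarrow> scan" where
  "scan_step j (m, c, f, g) (Dig l x t) =
     (m \<and> (j = 0 \<and> l \<noteq> 0 \<longrightarrow> x = t), c \<and> (l = j \<longrightarrow> \<not> x), f, g)"
| "scan_step j (m, c, f, g) Sep = (True, m, f \<or> m, g \<and> \<not> c)"
| "scan_step j st y = st"

fun scan_out :: "nat \<Rightarrow> scan \<Rightarrow> sym \<Rightarrow> sym" where
  "scan_out j (m, c, f, g) (Dig l x t) = Dig l (if l = j then x \<noteq> c else x) t"
| "scan_out j st y = y"

text \<open>For \<open>j > 0\<close> every block receives a borrow: the first one here, each later
  one because \<open>m\<close> is true at \<open>Sep\<close>. For \<open>j = 0\<close> no block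
  precedes the first, so none is pending.\<close>

definition scan_init :: "nat \<Rightarrow> scan" where
  "scan_init j = (True, j \<noteq> 0, j \<noteq> 0, True)"

text \<open>No separator follows the last block, so its underflow shows only as a pending borrow
  \<open>c\<close>.\<close>

fun succeeds :: "scan \<Rightarrow> bool" where
  "succeeds (m, c, f, g) \<longleftrightarrow> f \<and> g \<and> \<not> c"

fun scan_outs :: "nat \<Rightarrow> scan \<Rightarrow> sym list \<Rightarrow> sym list" where
  "scan_outs j st [] = []"
| "scan_outs j st (y # s) = scan_out j st y # scan_outs j (scan_step j st y) s"

abbreviation scan :: "nat \<Rightarrow> scan \<Rightarrow> sym list \<Rightarrow> scan" where
  "scan j \<equiv> foldl (scan_step j)"

definition act :: "nat \<Rightarrow> sym list \<Rightarrow> sym list" where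
  "act j s = scan_outs j (scan_init j) s"

definition ok :: "nat \<Rightarrow> sym list \<Rightarrow> bool" where
  "ok j s \<longleftrightarrow> succeeds (scan j (scan_init j) s)"

text \<open>
  On underflow the counters wrap around, which keeps \<^const>\<open>act\<close> injective; together with the label
  \<open>Dead j\<close> this makes the exits of all operations injective.
\<close>

definition opr :: "nat \<Rightarrow> sym list \<Rightarrow> sym list" where
  "opr j w = (if hd w = Live
     then (if ok j (rev (tl w)) then Live else Dead j) # rev (act j (rev (tl w)))
     else w @ [Dead j])"

text \<open>For a given state, an output letter determines the input letter and hence the next
  state.\<close>

lemma scan_outs_inject: "scan_outs j st s = scan_outs j st s' \<longleftrightarrow> s = s'"
proof (induction s arbitrary: st s')
  case Nil
  then show ?case by (cases s') auto
next
  case (Cons y s)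
  have "scan_out j st y = scan_out j st y' \<longleftrightarrow> y = y'" for y'
    by (cases st; cases y; cases y') auto
  with Cons.IH[of "scan_step j st y"] show ?case by (cases s') auto
qed

lemma act_inject [simp]: "act j s = act j s' \<longleftrightarrow> s = s'"
  by (simp add: act_def scan_outs_inject)

text \<open>Blocks are numbered in scan order, and the digit scanned first is least significant.
  Digits of different counters may interleave, so every word has counter values.\<close>

fun count :: "nat \<Rightarrow> sym list \<Rightarrow> nat \<Rightarrow> nat" where
  "count l [] b = 0"
| "count l (Sep # s) b = (case b of 0 \<Rightarrow> 0 | Suc b' \<Rightarrow> count l s b')"
| "count l (Dig l' x t # s) b = (if b = 0 \<and> l' = l then of_bool x + 2 * count l s 0 else count l s b)"
| "count l (_ # s) b = count l s b"

fun target :: "nat \<Rightarrow> sym list \<Rightarrow> nat \<Rightarrow> nat" where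
  "target l [] b = 0"
| "target l (Sep # s) b = (case b of 0 \<Rightarrow> 0 | Suc b' \<Rightarrow> target l s b')"
| "target l (Dig l' x t # s) b = (if b = 0 \<and> l' = l then of_bool t + 2 * target l s 0 else target l s b)"
| "target l (_ # s) b = target l s b"

text \<open>\<open>m\<close> is the verdict on the part of block 0 scanned so far, as in a scan
  state.\<close>

fun matches :: "bool \<Rightarrow> sym list \<Rightarrow> nat \<Rightarrow> bool" where
  "matches m [] b = m"
| "matches m (Sep # s) b = (case b of 0 \<Rightarrow> m | Suc b' \<Rightarrow> matches True s b')"
| "matches m (Dig l x t # s) b = matches (m \<and> (l \<noteq> 0 \<longrightarrow> x = t)) s b"
| "matches m (_ # s) b = matches m s b"

section \<open>The effect of a scan on counters, targets and matches\<close>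

abbreviation seps :: "sym list \<Rightarrow> nat" where
  "seps s \<equiv> count_list s Sep"

lemma seps_scan_outs [simp]: "seps (scan_outs j st s) = seps s"
proof (induction s arbitrary: st)
  case (Cons y s)
  then show ?case by (cases st; cases y) auto
qed simp

lemma target_scan_outs [simp]: "target l (scan_outs j st s) b = target l s b"
proof (induction s arbitrary: st b)
  case (Cons y s)
  then show ?case by (cases st; cases y) (auto split: nat.split)
qed simp

lemma count_scan_outs_other: "l \<noteq> j \<Longrightarrow> count l (scan_outs j st s) b = count l s b"
proof (induction s arbitrary: st b)
  case (Cons y s)
  then show ?case by (cases st; cases y) (auto split: nat.split)
qed simp

text \<open>Once lowered, \<open>g\<close> never recovers.\<close>

lemma scan_no_underflow: "succeeds (scan j (m, c, f, g) s) \<Longrightarrow> g"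
proof (induction s arbitrary: m c f g)
  case (Cons y s)
  from Cons.prems show ?case by (cases y) (auto dest: Cons.IH)
qed simp

text \<open>The scan may start inside block 0, which still owes the borrow \<open>c\<close>; every
  later block receives a new borrow at its separator.\<close>

lemma count_scan_outs_move:
  assumes "j \<noteq> 0" "succeeds (scan j (True, c, f, g) s)" "b \<le> seps s"
  shows "count j s b = count j (scan_outs j (True, c, f, g) s) b + (if b = 0 then of_bool c else 1)"
  using assms
proof (induction s arbitrary: c f g b)
  case (Cons y s)
  show ?case
  proof (cases y)
    case Sep
    \<comment> \<open>A borrow left over at the separator would be an underflow.\<close>
    with Cons.prems have "\<not> c" using scan_no_underflow[of j True True "f \<or> True" "g \<and> \<not> c" s] by simp
    with Sep Cons.prems Cons.IH[of True True "g \<and> \<not> c"] show ?thesis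
      by (auto split: nat.split)
  next
    case (Dig l x t)
    \<comment> \<open>With new borrow \<open>c'\<close> and output bit \<open>x'\<close>, the bits
      satisfy x = x' + c - 2 * c'; the tail, weighted by 2, accounts for \<open>c'\<close>.\<close>
    with Cons.prems Cons.IH[of "c \<and> (l = j \<longrightarrow> \<not> x)" f g b]
      Cons.IH[of "c \<and> (l = j \<longrightarrow> \<not> x)" f g 0] show ?thesis
      by (auto split: if_splits)
  qed (use Cons in auto)
qed simp

text \<open>The subtraction is that of a move, but the borrow entering block \<open>Suc b'\<close>
  is the verdict on block \<open>b'\<close>.\<close>

lemma count_scan_outs_lamp:
  assumes "succeeds (scan 0 (m, c, f, g) s)" "b \<le> seps s"
  shows "count 0 s b = count 0 (scan_outs 0 (m, c, f, g) s) b +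
    of_bool (case b of 0 \<Rightarrow> c | Suc b' \<Rightarrow> matches m s b')"
  using assms
proof (induction s arbitrary: m c f g b)
  case (Cons y s)
  show ?case
  proof (cases y)
    case Sep
    with Cons.prems have "\<not> c" using scan_no_underflow[of 0 True m "f \<or> m" "g \<and> \<not> c" s] by simp
    with Sep Cons.prems Cons.IH[of True m "f \<or> m" "g \<and> \<not> c"] show ?thesis
      by (auto split: nat.split)
  next
    case (Dig l x t)
    with Cons.prems Cons.IH[of "m \<and> (l \<noteq> 0 \<longrightarrow> x = t)" "c \<and> (l = 0 \<longrightarrow> \<not> x)" f g b] show ?thesis
      by (cases b) auto
  qed (use Cons in \<open>auto split: nat.splits\<close>)
qed simp

text \<open>The flag \<open>f\<close> can be raised only at a separator that closes a matching
  block, hence \<open>b < seps s\<close>.\<close>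

lemma scan_found:
  "succeeds (scan 0 (m, c, f, g) s) \<Longrightarrow> f \<or> (\<exists>b<seps s. matches m s b)"
proof (induction s arbitrary: m c f g)
  case (Cons y s)
  show ?case
  proof (cases y)
    case Sep
    with Cons.IH[of True m "f \<or> m" "g \<and> \<not> c"] Cons.prems
    consider "f" | "m" | b where "b < seps s" "matches True s b" by auto
    then show ?thesis
    proof cases
      case 3
      then show ?thesis using Sep by (intro disjI2 exI[of _ "Suc b"]) simp
    qed (use Sep in \<open>auto intro!: exI[of _ 0]\<close>)
  next
    case (Dig l x t)
    with Cons.prems Cons.IH[of "m \<and> (l \<noteq> 0 \<longrightarrow> x = t)" "c \<and> (l = 0 \<longrightarrow> \<not> x)" f g] show ?thesis
      by simp
  qed (use Cons.prems Cons.IH[of m c f g] in auto)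
qed simp

lemma matchesD: "matches m s 0 \<Longrightarrow> m"
  by (induction m s "0::nat" rule: matches.induct) auto

text \<open>Each digit carries a counter bit and a target bit, so both numbers have equal length and
  agree bit by bit.\<close>

lemma count_eq_target_if_matches:
  "matches m s b \<Longrightarrow> l \<noteq> 0 \<Longrightarrow> count l s b = target l s b"
proof (induction s arbitrary: m b)
  case (Cons y s)
  show ?case
  proof (cases y)
    case (Dig l' x t)
    then show ?thesis using Cons matchesD by (cases b) force+
  qed (use Cons in \<open>auto split: nat.splits\<close>)
qed simp

text \<open>
  The block \<open>b\<close> is at its target exactly when its address equals the position, and addresses are
  invariant under successful moves. Only blocks followed by a separator control a lamp, namely that of the block
  \<open>Suc b\<close>.
\<close>

definition pos :: "nat \<Rightarrow> sym list \<Rightarrow> nat \<Rightarrow> int" where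
  "pos i s l = (if 1 \<le> l \<and> l \<le> i then int (count l s 0) else 0)"

definition address :: "nat \<Rightarrow> sym list \<Rightarrow> nat \<Rightarrow> nat \<Rightarrow> int" where
  "address i s b l =
     (if 1 \<le> l \<and> l \<le> i then int (count l s 0) - int (count l s b) + int (target l s b) else 0)"

text \<open>Summing over blocks with equal address covers words that repeat an address: a successful
  lamp operation still affects one entry only.\<close>

definition lamps :: "nat \<Rightarrow> sym list \<Rightarrow> (nat \<Rightarrow> int) \<Rightarrow> nat" where
  "lamps i s x = (\<Sum>b<seps s. if address i s b = x then count 0 s (Suc b) else 0)"

section \<open>Successful operations on positions, addresses and lamps\<close>

lemma seps_act [simp]: "seps (act j s) = seps s"
  by (simp add: act_def)

lemma pos_move:
  assumes "j \<noteq> 0" "j \<le> i" "ok j s"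
  shows "pos i (act j s) = (pos i s)(j := pos i s j - 1)"
  using assms count_scan_outs_move[of j True True True s 0]
  by (auto simp: pos_def act_def ok_def scan_init_def count_scan_outs_other fun_eq_iff)

text \<open>The counter falls by one in block 0 and in block \<open>b\<close> alike, and targets are
  constant.\<close>

lemma address_move:
  assumes "j \<noteq> 0" "ok j s" "b < seps s"
  shows "address i (act j s) b = address i s b"
proof
  fix l
  show "address i (act j s) b l = address i s b l"
  proof (cases "l = j")
    case True
    with assms count_scan_outs_move[of j True True True s 0]
      count_scan_outs_move[of j True True True s b] show ?thesis
      by (auto simp: address_def act_def ok_def scan_init_def)
  next
    case False
    then show ?thesis by (simp add: address_def act_def count_scan_outs_other)
  qed
qed

lemma lamps_move:
  assumes "j \<noteq> 0" "ok j s"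
  shows "lamps i (act j s) = lamps i s"
proof
  fix x
  have "count 0 (act j s) b = count 0 s b" for b
    using assms by (simp add: act_def count_scan_outs_other)
  with assms show "lamps i (act j s) x = lamps i s x"
    unfolding lamps_def by (intro sum.cong) (simp_all add: address_move)
qed

lemma pos_lamp: "pos i (act 0 s) = pos i s"
  by (auto simp: pos_def act_def count_scan_outs_other)

lemma address_lamp: "address i (act 0 s) b = address i s b"
  by (auto simp: address_def act_def count_scan_outs_other)

lemma address_if_matches: "matches True s b \<Longrightarrow> address i s b = pos i s"
  using count_eq_target_if_matches[of True s b] by (auto simp: address_def pos_def)

lemma count_lamp:
  assumes "ok 0 s" "b < seps s"
  shows "count 0 s (Suc b) = count 0 (act 0 s) (Suc b) + of_bool (matches True s b)"
  using count_scan_outs_lamp[of True False False True s "Suc b"] assms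
  by (simp add: ok_def act_def scan_init_def)

text \<open>Only the lamps controlled by matching blocks fall, and such blocks have address
  \<open>pos i s\<close>.\<close>

lemma lamps_lamp_other:
  assumes "ok 0 s" "x \<noteq> pos i s"
  shows "lamps i (act 0 s) x = lamps i s x"
  using assms address_if_matches[of s _ i]
  by (auto simp: lamps_def address_lamp count_lamp intro!: sum.cong)

text \<open>Success guarantees a matching block. Several blocks may match, so the entry can fall by
  more than one.\<close>

lemma lamps_lamp:
  assumes "ok 0 s"
  shows "lamps i (act 0 s) (pos i s) < lamps i s (pos i s)"
proof -
  obtain b where b: "b < seps s" "matches True s b"
    using scan_found[of True False False True s] assms by (auto simp: ok_def scan_init_def)
  then show ?thesis
    unfolding lamps_def seps_act address_lamp
    by (intro sum_strict_mono_ex1)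
      (use b assms in \<open>auto simp: count_lamp address_if_matches intro!: bexI[of _ b]\<close>)
qed

section \<open>The lower bound for sets of words\<close>

definition ops_boundary :: "nat \<Rightarrow> sym list set \<Rightarrow> sym list set" where
  "ops_boundary i W = {w \<in> W. \<exists>j\<le>i. opr j w \<notin> W}"

lemma opr_append_inject: "hd v \<noteq> Live \<Longrightarrow> hd w \<noteq> Live \<Longrightarrow> opr j v = opr l w \<longleftrightarrow> v = w \<and> j = l"
  by (auto simp: opr_def)

text \<open>Dead words expand, so the boundary controls their number and also the number of live
  words on which some operation fails. The remaining live words form the interior
  \<open>I\<close>.\<close>

lemma ops_lower_bound:
  assumes "1 \<le> i" and fin: "finite W" and ne: "[] \<notin> W"
    and small: "card (ops_boundary i W) * ((2 * Suc i ^ 2 + 2) * n) < card W" and n: "1 \<le> n"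
  shows "n ^ (n ^ i) \<le> card W"
proof -
  define B where "B = ops_boundary i W"
  define D where "D = {w \<in> W. hd w \<noteq> Live}"
  define V where "V = {w \<in> W. hd w = Live}"
  define I where "I = {w \<in> V. \<forall>j\<le>i. ok j (rev (tl w)) \<and> opr j w \<in> V}"
  define E where "E j = {w \<in> V - B. \<not> ok j (rev (tl w))}" for j
  have finD: "finite D" and finV: "finite V" and finB: "finite B"
    using fin by (auto simp: D_def V_def B_def ops_boundary_def)
  have cW: "card W = card V + card D"
    unfolding D_def V_def using fin
    by (subst card_Un_disjoint[symmetric]) (auto intro: arg_cong[of _ _ card])
  have cB: "card B = card (B \<inter> V) + card (B \<inter> D)"
    unfolding D_def V_def using finB
    by (subst card_Un_disjoint[symmetric])
      (auto intro!: arg_cong[of _ _ card] simp: B_def ops_boundary_def)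
  \<comment> \<open>Operations 0 and 1 append different letters, so \<open>D - B\<close> has two
    disjoint injective images in \<open>D\<close>; at least half of \<open>D\<close> is
    boundary.\<close>
  have "card (D - B) + card (D - B) = card (opr 0 ` (D - B)) + card (opr 1 ` (D - B))"
    by (subst (1 2) card_image) (auto simp: inj_on_def D_def opr_append_inject)
  also have "\<dots> = card (opr 0 ` (D - B) \<union> opr 1 ` (D - B))"
    using finD by (subst card_Un_disjoint) (auto simp: D_def opr_append_inject)
  also have "\<dots> \<le> card D"
  proof (rule card_mono[OF finD])
    have "opr j w \<in> D" if "j \<le> 1" "w \<in> D - B" for j w
    proof -
      have "opr j w \<in> W" using that \<open>1 \<le> i\<close> by (auto simp: D_def B_def ops_boundary_def)
      moreover have "w \<noteq> []" using that ne by (auto simp: D_def)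
      ultimately show ?thesis using that by (auto simp: D_def opr_def)
    qed
    then show "opr 0 ` (D - B) \<union> opr 1 ` (D - B) \<subseteq> D" by auto
  qed
  finally have "card D \<le> 2 * card (B \<inter> D)"
    using finD by (simp add: card_Diff_subset_Int Int_commute card_mono)
  have Live: "\<exists>u. w = Live # u" if "w \<in> V" for w
    using that ne by (cases w) (auto simp: V_def)
  \<comment> \<open>Failing words go injectively into the dead part, since \<open>act j\<close> is
    injective even when counters wrap around.\<close>
  have E: "card (E j) \<le> card D" if j: "j \<le> i" for j
  proof (rule card_inj_on_le[OF _ _ finD])
    show "inj_on (opr j) (E j)"
    proof (rule inj_onI)
      fix v w assume vw: "v \<in> E j" "w \<in> E j" "opr j v = opr j w"
      moreover obtain u u' where "v = Live # u" "w = Live # u'"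
        using vw Live[of v] Live[of w] by (auto simp: E_def)
      ultimately show "v = w" by (simp add: E_def opr_def)
    qed
    show "opr j ` E j \<subseteq> D"
      using j by (auto simp: E_def opr_def D_def V_def B_def ops_boundary_def)
  qed
  \<comment> \<open>Off the boundary, a live word misses \<open>I\<close> only if some operation
    fails on it.\<close>
  have "V - I \<subseteq> (B \<inter> V) \<union> (\<Union>j\<in>{..i}. E j)"
    by (auto simp: I_def E_def V_def B_def ops_boundary_def opr_def)
  then have "card (V - I) \<le> card ((B \<inter> V) \<union> (\<Union>j\<in>{..i}. E j))"
    using finV finB by (intro card_mono) (auto simp: E_def)
  also have "\<dots> \<le> card (B \<inter> V) + (\<Sum>j\<in>{..i}. card (E j))"
    by (rule order_trans[OF card_Un_le]) (simp add: card_UN_le)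
  also have "\<dots> \<le> card (B \<inter> V) + Suc i * card D"
    using sum_mono[of "{..i}" "\<lambda>j. card (E j)" "\<lambda>_. card D"] E by simp
  also have "\<dots> \<le> card (B \<inter> V) + Suc i * (2 * card (B \<inter> D))"
    using \<open>card D \<le> _\<close> by (intro add_left_mono mult_le_mono2)
  also have "\<dots> \<le> 2 * Suc i * card B" using cB by (simp add: algebra_simps)
  finally have VI: "card (V - I) \<le> 2 * Suc i * card B" .
  have "n * (Suc i * card (V - I)) \<le> n * (Suc i * (2 * Suc i * card B))"
    using VI by (intro mult_le_mono2)
  also have "\<dots> = card B * (2 * Suc i ^ 2 * n)" by (simp add: power2_eq_square algebra_simps)
  also have "\<dots> < card V"
  proof -
    \<comment> \<open>The last summand 2 of the constant pays for the dead words, at most twice the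
      boundary; the rest is the cost of thinning.\<close>
    have "card B * (2 * Suc i ^ 2 * n) + 2 * (card B * n) = card (ops_boundary i W) * ((2 * Suc i ^ 2 + 2) * n)"
      unfolding B_def[symmetric] by (simp add: algebra_simps)
    moreover have "card B \<le> card B * n" using n by simp
    ultimately show ?thesis using small cW cB \<open>card D \<le> _\<close> by linarith
  qed
  finally have small': "n * (Suc i * card (V - I)) < card V" .
  have "n ^ (n ^ i) \<le> card V"
  proof (rule card_ge_power_power[OF finV _ _ _ _ _ _ _ _ _ small'])
    show "inj_on (opr j) I" for j
    proof (rule inj_onI)
      fix v w assume vw: "v \<in> I" "w \<in> I" "opr j v = opr j w"
      moreover obtain u u' where "v = Live # u" "w = Live # u'"
        using vw Live[of v] Live[of w] by (auto simp: I_def)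
      ultimately show "v = w" by (simp add: opr_def)
    qed
    let ?p = "\<lambda>w. pos i (rev (tl w))" and ?c = "\<lambda>w. lamps i (rev (tl w))"
    have step: "rev (tl (opr j w)) = act j (rev (tl w))" "ok j (rev (tl w))" if "w \<in> I" "j \<le> i" for j w
      using that by (auto simp: I_def opr_def V_def)
    show "0 \<le> ?p w j" for w j by (simp add: pos_def)
    show "?p (opr j w) = (?p w)(j := ?p w j - 1)" "?c (opr j w) = ?c w"
      if "1 \<le> j" "j \<le> i" "w \<in> I" for j w
      using that by (auto simp: step pos_move lamps_move)
    show "?p (opr 0 w) = ?p w" "?c (opr 0 w) (?p w) < ?c w (?p w)" if "w \<in> I" for w
      using that by (auto simp: step pos_lamp lamps_lamp)
    show "?c (opr 0 w) x = ?c w x" if "w \<in> I" "x \<noteq> ?p w" for w x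
      using that by (auto simp: step lamps_lamp_other)
  qed (auto simp: I_def)
  then show ?thesis using cW by linarith
qed

section \<open>Boxes\<close>

definition letters :: "nat \<Rightarrow> sym set" where
  "letters i = {Live, Sep} \<union> Dead ` {..i} \<union> (\<lambda>(l, x, t). Dig l x t) ` ({..i} \<times> UNIV)"

lemma letters_iff [simp]:
  "Live \<in> letters i" "Sep \<in> letters i" "Dead j \<in> letters i \<longleftrightarrow> j \<le> i"
  "Dig l x t \<in> letters i \<longleftrightarrow> l \<le> i" "Blank \<notin> letters i" "Mark \<notin> letters i"
  by (auto simp: letters_def image_iff)

lemma finite_letters: "finite (letters i)"
  by (simp add: letters_def)

fun digits :: "nat \<Rightarrow> nat \<Rightarrow> nat \<Rightarrow> nat \<Rightarrow> sym list" where
  "digits l 0 v t = []"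
| "digits l (Suc a) v t = Dig l (odd v) (odd t) # digits l a (v div 2) (t div 2)"

definition block :: "nat \<Rightarrow> nat list \<Rightarrow> (nat \<Rightarrow> nat) \<Rightarrow> (nat \<Rightarrow> nat) \<Rightarrow> sym list" where
  "block a ls k p = concat (map (\<lambda>l. digits l a (k l) (p l)) ls)"

text \<open>In scan order the lamp controlled by block \<open>p\<close> follows the separator, hence
  lies in the next block.\<close>

definition cell :: "nat \<Rightarrow> nat list \<Rightarrow> (nat \<Rightarrow> nat) \<Rightarrow> ((nat \<Rightarrow> nat) \<Rightarrow> nat) \<Rightarrow> (nat \<Rightarrow> nat) \<Rightarrow> sym list" where
  "cell a ls k f p = block a ls k p @ Sep # digits 0 a (f p) 0"

text \<open>
  The last block controls no lamp. It is present because a block without digits would underflow at once.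
\<close>

definition config_word :: "nat \<Rightarrow> nat list \<Rightarrow> (nat \<Rightarrow> nat) list \<Rightarrow> (nat \<Rightarrow> nat) \<Rightarrow> ((nat \<Rightarrow> nat) \<Rightarrow> nat) \<Rightarrow> sym list" where
  "config_word a ls ps k f = concat (map (cell a ls k f) ps) @ block a ls k (\<lambda>_. 0)"

section \<open>Scanning the words of a box\<close>

lemma scan_outs_append [simp]:
  "scan_outs j st (s @ s') = scan_outs j st s @ scan_outs j (scan j st s) s'"
  by (induction s arbitrary: st) auto

lemma length_digits [simp]: "length (digits l a v t) = a"
  by (induction a arbitrary: v t) auto

lemma digits_inject:
  "v < 2 ^ a \<Longrightarrow> v' < 2 ^ a \<Longrightarrow> digits l a v t = digits l a v' t \<longleftrightarrow> v = v'"
proof (induction a arbitrary: v v' t)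
  case (Suc a)
  then have "digits l a (v div 2) (t div 2) = digits l a (v' div 2) (t div 2) \<longleftrightarrow> v div 2 = v' div 2"
    by (intro Suc.IH) auto
  then show ?case
    by simp (metis odd_two_times_div_two_succ even_two_times_div_two)
qed simp

lemma set_digits: "l \<le> i \<Longrightarrow> set (digits l a v t) \<subseteq> letters i"
  by (induction a arbitrary: v t) auto

lemma scan_digits_idle:
  assumes "l \<noteq> j \<or> \<not> c" "j \<noteq> 0 \<or> l = 0"
  shows "scan j (m, c, f, g) (digits l a v t) = (m, c, f, g)"
    "scan_outs j (m, c, f, g) (digits l a v t) = digits l a v t"
  using assms by (induction a arbitrary: v t) auto

lemma scan_digits_compare:
  assumes "l \<noteq> 0" "v < 2 ^ a" "t < 2 ^ a"
  shows "scan 0 (m, c, f, g) (digits l a v t) = (m \<and> v = t, c, f, g)"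
    "scan_outs 0 (m, c, f, g) (digits l a v t) = digits l a v t"
  using assms
proof (induction a arbitrary: m v t)
  case (Suc a)
  {
    case 1
    then have "scan 0 (m \<and> odd v = odd t, c, f, g) (digits l a (v div 2) (t div 2)) =
        ((m \<and> odd v = odd t) \<and> v div 2 = t div 2, c, f, g)"
      by (intro Suc.IH) auto
    with 1 show ?case by simp (metis odd_two_times_div_two_succ even_two_times_div_two)
  next
    case 2
    then have "scan_outs 0 (m \<and> odd v = odd t, c, f, g) (digits l a (v div 2) (t div 2)) =
        digits l a (v div 2) (t div 2)"
      by (intro Suc.IH) auto
    with 2 show ?case by simp
  }
qed auto

lemma scan_digits_decrement:
  assumes "0 < v" "v < 2 ^ a"
  shows "scan l (m, True, f, g) (digits l a v t) = (m, False, f, g)"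
    "scan_outs l (m, True, f, g) (digits l a v t) = digits l a (v - 1) t"
proof -
  have "scan l (m, True, f, g) (digits l a v t) = (m, False, f, g) \<and>
    scan_outs l (m, True, f, g) (digits l a v t) = digits l a (v - 1) t"
    using assms
  proof (induction a arbitrary: v t)
    case (Suc a)
    show ?case
    proof (cases "odd v")
      case True
      then obtain u where "v = 2 * u + 1" by (elim oddE)
      then show ?thesis by (cases "l = 0") (simp_all add: scan_digits_idle)
    next
      case False
      then obtain w where "v = 2 * w" by (auto elim: evenE)
      \<comment> \<open>A positive even number is 2 * (u + 1): the low bit becomes 1 and the borrow
        passes to u + 1.\<close>
      with Suc.prems obtain u where u: "v = 2 * u + 2" "Suc u < 2 ^ a" by (cases w) auto
      with Suc.IH[of "Suc u" "t div 2"] show ?thesis by (cases "l = 0") simp_all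
    qed
  qed auto
  then show "scan l (m, True, f, g) (digits l a v t) = (m, False, f, g)"
    "scan_outs l (m, True, f, g) (digits l a v t) = digits l a (v - 1) t" by auto
qed

lemma scan_block_idle:
  assumes "j \<noteq> 0" "j \<notin> set ls \<or> \<not> c"
  shows "scan j (m, c, f, g) (block a ls k p) = (m, c, f, g)"
    "scan_outs j (m, c, f, g) (block a ls k p) = block a ls k p"
  using assms by (induction ls) (auto simp: block_def scan_digits_idle)

lemma scan_block_compare:
  assumes "0 \<notin> set ls" "\<And>l. l \<in> set ls \<Longrightarrow> k l < 2 ^ a \<and> p l < 2 ^ a"
  shows "scan 0 (m, c, f, g) (block a ls k p) = (m \<and> (\<forall>l\<in>set ls. k l = p l), c, f, g)"
    "scan_outs 0 (m, c, f, g) (block a ls k p) = block a ls k p"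
  using assms by (induction ls arbitrary: m) (auto simp: block_def scan_digits_compare)

lemma scan_block_move:
  assumes "distinct ls" "j \<in> set ls" "j \<noteq> 0" "0 < k j" "k j < 2 ^ a"
  shows "scan j (m, True, f, g) (block a ls k p) = (m, False, f, g)"
    "scan_outs j (m, True, f, g) (block a ls k p) = block a ls (k(j := k j - 1)) p"
proof -
  obtain xs ys where ls: "ls = xs @ j # ys" using assms(2) by (meson split_list)
  have b: "block a ls k' p = block a xs k' p @ digits j a (k' j) (p j) @ block a ys k' p" for k'
    by (simp add: block_def ls)
  have j: "j \<notin> set xs" "j \<notin> set ys" using assms(1) ls by auto
  then have "block a xs (k(j := k j - 1)) p = block a xs k p" "block a ys (k(j := k j - 1)) p = block a ys k p"
    unfolding block_def by (intro arg_cong[of _ _ concat] map_cong; auto)+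
  then show "scan j (m, True, f, g) (block a ls k p) = (m, False, f, g)"
    "scan_outs j (m, True, f, g) (block a ls k p) = block a ls (k(j := k j - 1)) p"
    using j assms by (simp_all add: b scan_block_idle scan_digits_decrement)
qed

lemma config_word_move:
  assumes "distinct ls" "j \<in> set ls" "j \<noteq> 0" "0 < k j" "k j < 2 ^ a"
  shows "act j (config_word a ls ps k f) = config_word a ls ps (k(j := k j - 1)) f"
    "ok j (config_word a ls ps k f)"
proof -
  let ?st = "(True, True, True, True)"
  \<comment> \<open>After each cell the scan is back in its initial state: the block absorbs the
    borrow and the separator issues a new one.\<close>
  have "scan j ?st (concat (map (cell a ls k f) ps)) = ?st \<and>
    scan_outs j ?st (concat (map (cell a ls k f) ps)) = concat (map (cell a ls (k(j := k j - 1)) f) ps)"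
    using assms by (induction ps) (auto simp: cell_def scan_block_move scan_digits_idle)
  then show "act j (config_word a ls ps k f) = config_word a ls ps (k(j := k j - 1)) f"
    "ok j (config_word a ls ps k f)"
    using assms by (simp_all add: act_def ok_def config_word_def scan_init_def scan_block_move)
qed

lemma config_word_lamp:
  assumes "distinct ls" "0 \<notin> set ls" "set ps = (\<Pi>\<^sub>E l\<in>set ls. {..<2 ^ a})" "k \<in> set ps"
    and "0 < f k" "f k < 2 ^ a"
  shows "act 0 (config_word a ls ps k f) = config_word a ls ps k (f(k := f k - 1))"
    "ok 0 (config_word a ls ps k f)"
proof -
  have less: "p l < 2 ^ a" if "p \<in> set ps" "l \<in> set ls" for p l
    using that assms(3) by (auto simp: PiE_def)
  have eq: "(\<forall>l\<in>set ls. k l = p l) \<longleftrightarrow> k = p" if "p \<in> set ps" for p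
    using that assms(3,4) by (metis PiE_ext)
  \<comment> \<open>Between cells no borrow is pending, and the third flag records whether target
    \<open>k\<close> has been passed. Repeated targets share the value \<open>f k\<close>, so one
    update serves them all.\<close>
  have "scan 0 (True, False, b, True) (concat (map (cell a ls k f) qs)) = (True, False, b \<or> k \<in> set qs, True) \<and>
    scan_outs 0 (True, False, b, True) (concat (map (cell a ls k f) qs)) =
      concat (map (cell a ls k (f(k := f k - 1))) qs)" if "set qs \<subseteq> set ps" for qs b
    using that
  proof (induction qs arbitrary: b)
    case (Cons q qs)
    then have c: "scan 0 (m, c, f', g) (block a ls k q) = (m \<and> k = q, c, f', g)"
       "scan_outs 0 (m, c, f', g) (block a ls k q) = block a ls k q" for m c f' g
      using scan_block_compare[of ls k a q] assms less eq by auto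
    have "scan 0 (True, k = q, b', True) (digits 0 a (f q) 0) = (True, False, b', True)"
      "scan_outs 0 (True, k = q, b', True) (digits 0 a (f q) 0) = digits 0 a ((f(k := f k - 1)) q) 0" for b'
      using assms by (cases "k = q"; simp add: scan_digits_idle scan_digits_decrement)+
    with Cons c show ?case by (auto simp: cell_def)
  qed simp
  from this[of ps False] show "act 0 (config_word a ls ps k f) = config_word a ls ps k (f(k := f k - 1))"
    "ok 0 (config_word a ls ps k f)"
    using assms less scan_block_compare[of ls k a "\<lambda>_. 0"]
    by (simp_all add: act_def ok_def config_word_def scan_init_def)
qed

lemma length_block [simp]: "length (block a ls k p) = length ls * a"
  by (induction ls) (auto simp: block_def)

lemma block_inject:
  assumes "\<And>l. l \<in> set ls \<Longrightarrow> k l < 2 ^ a \<and> k' l < 2 ^ a"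
  shows "block a ls k p = block a ls k' p \<longleftrightarrow> (\<forall>l\<in>set ls. k l = k' l)"
  using assms by (induction ls) (auto simp: block_def digits_inject)

lemma config_word_inject:
  assumes "\<And>l. l \<in> set ls \<Longrightarrow> k l < 2 ^ a \<and> k' l < 2 ^ a"
    and "\<And>p. p \<in> set ps \<Longrightarrow> f p < 2 ^ a \<and> f' p < 2 ^ a"
    and "config_word a ls ps k f = config_word a ls ps k' f'"
  shows "(\<forall>l\<in>set ls. k l = k' l) \<and> (\<forall>p\<in>set ps. f p = f' p)"
proof -
  have "length (concat (map (cell a ls k f) ps)) = length (concat (map (cell a ls k' f') ps))"
    by (induction ps) (auto simp: cell_def)
  with assms(3) have e: "concat (map (cell a ls k f) ps) = concat (map (cell a ls k' f') ps)"
    "block a ls k (\<lambda>_. 0) = block a ls k' (\<lambda>_. 0)"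
    by (auto simp: config_word_def)
  have "\<forall>p\<in>set ps. f p = f' p"
    using assms(2) e(1) by (induction ps) (auto simp: cell_def digits_inject)
  with e(2) show ?thesis using block_inject assms(1) by blast
qed

lemma set_config_word:
  assumes "set ls \<subseteq> {..i}"
  shows "set (config_word a ls ps k f) \<subseteq> letters i"
proof -
  have b: "set (block a ls k p) \<subseteq> letters i" for p
    using assms set_digits[of _ i a] unfolding block_def by fastforce
  have "set (cell a ls k f p) \<subseteq> letters i" for p
    using b[of p] set_digits[of 0 i a] by (auto simp: cell_def)
  then show ?thesis using b unfolding config_word_def by fastforce
qed

text \<open>Replacing the value 0 at \<open>x\<close> by each of \<open>M\<close> values yields
  pairwise distinct functions.\<close>

lemma card_PiE_zero_le:
  fixes M :: nat
  assumes "finite S" "x \<in> S"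
  shows "card {f \<in> S \<rightarrow>\<^sub>E {..<M}. f x = 0} * M \<le> M ^ card S"
proof -
  have "inj_on (\<lambda>(f, v). f(x := v)) ({f \<in> S \<rightarrow>\<^sub>E {..<M}. f x = 0} \<times> {..<M})"
  proof (rule inj_onI, clarify)
    fix f v f' v'
    assume *: "f x = (0::nat)" "f' x = 0" "f(x := v) = f'(x := v')"
    have "f = (f(x := v))(x := 0)" "f' = (f'(x := v'))(x := 0)" using *(1,2) by auto
    with * show "f = f' \<and> v = v'" by (metis fun_upd_same)
  qed
  then have "card ({f \<in> S \<rightarrow>\<^sub>E {..<M}. f x = 0} \<times> {..<M}) \<le> card (S \<rightarrow>\<^sub>E {..<M})"
  proof (rule card_inj_on_le)
    show "(\<lambda>(f, v). f(x := v)) ` ({f \<in> S \<rightarrow>\<^sub>E {..<M}. f x = 0} \<times> {..<M}) \<subseteq> S \<rightarrow>\<^sub>E {..<M}"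
      using assms by (auto simp: PiE_iff extensional_def)
  qed (use assms in \<open>simp add: finite_PiE\<close>)
  then show ?thesis using assms by (simp add: card_cartesian_product card_PiE)
qed

text \<open>An operation leaves the box only where its coordinate is 0, which is at most one point
  in \<open>M\<close>; there are \<open>i + 1\<close> operations.\<close>

lemma ops_upper_bound:
  fixes i a :: nat
  defines "M \<equiv> 2 ^ a"
  shows "\<exists>W. finite W \<and> W \<subseteq> lists (letters i) - {[]} \<and>
    card W = M ^ i * M ^ (M ^ i) \<and> card (ops_boundary i W) * M \<le> Suc i * card W"
proof -
  define ls where "ls = [1..<Suc i]"
  define P where "P = {1..i} \<rightarrow>\<^sub>E {..<M}"
  define F where "F = P \<rightarrow>\<^sub>E {..<M}"
  have fin: "finite P" "finite F" by (auto simp: P_def F_def intro!: finite_PiE)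
  have card: "card P = M ^ i" "card F = M ^ (M ^ i)"
    using fin by (simp_all add: P_def F_def card_PiE)
  obtain ps where ps: "set ps = P" using fin finite_list by blast
  have ls: "set ls = {1..i}" "distinct ls" by (auto simp: ls_def)
  define w where "w = (\<lambda>(k, f). Live # rev (config_word a ls ps k f))"
  \<comment> \<open>The points at which operation \<open>j\<close> would underflow.\<close>
  define Z where "Z j = (if j = 0 then (SIGMA k:P. {f \<in> F. f k = 0}) else {k \<in> P. k j = 0} \<times> F)" for j
  have inj: "inj_on w (P \<times> F)"
  proof (rule inj_onI, clarify)
    fix k f k' f'
    assume *: "k \<in> P" "f \<in> F" "k' \<in> P" "f' \<in> F" "w (k, f) = w (k', f')"
    then have "(\<forall>l\<in>set ls. k l = k' l) \<and> (\<forall>p\<in>set ps. f p = f' p)"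
      by (intro config_word_inject[of _ _ a]) (auto simp: w_def P_def F_def M_def ls ps PiE_iff)
    with * show "k = k' \<and> f = f'"
      unfolding ls ps P_def F_def by (metis PiE_ext)
  qed
  have stay: "opr j (w (k, f)) \<in> w ` (P \<times> F)"
    if "k \<in> P" "f \<in> F" "j \<le> i" "(k, f) \<notin> Z j" for j k f
  proof (cases "j = 0")
    case True
    then have "f k \<noteq> 0" using that by (auto simp: Z_def)
    moreover have "f k < M" using that by (auto simp: F_def)
    ultimately have "opr j (w (k, f)) = w (k, f(k := f k - 1))"
      using config_word_lamp[of ls ps a k f] True that ps ls
      by (simp add: w_def opr_def P_def M_def)
    moreover have "f(k := f k - 1) \<in> F"
      using that \<open>f k < M\<close> by (auto simp: F_def PiE_iff extensional_def)
    ultimately show ?thesis using that by simp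
  next
    case False
    then have "k j \<noteq> 0" using that by (auto simp: Z_def)
    moreover have "k j < M" using that False by (auto simp: P_def PiE_iff)
    ultimately have "opr j (w (k, f)) = w (k(j := k j - 1), f)"
      using config_word_move[of ls j k a ps f] False that ls
      by (simp add: w_def opr_def M_def)
    moreover have "k(j := k j - 1) \<in> P"
      using that False \<open>k j < M\<close> by (auto simp: P_def PiE_iff extensional_def less_imp_diff_less)
    ultimately show ?thesis using that by simp
  qed
  have Z: "card (Z j) * M \<le> card P * card F" if j: "j \<le> i" for j
  proof (cases "j = 0")
    case True
    have "card (Z j) * M = (\<Sum>k\<in>P. card {f \<in> F. f k = 0} * M)"
      using True fin by (simp add: Z_def card_SigmaI sum_distrib_right)
    also have "\<dots> \<le> (\<Sum>k\<in>P. card F)"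
      using card_PiE_zero_le[OF fin(1)] card by (intro sum_mono) (simp add: F_def)
    finally show ?thesis by simp
  next
    case False
    have "card {k \<in> P. k j = 0} * M \<le> card P"
      using card_PiE_zero_le[of "{1..i}" j M] False j card by (simp add: P_def)
    then show ?thesis using False by (simp add: Z_def card_cartesian_product mult.commute mult.left_commute)
  qed
  have "ops_boundary i (w ` (P \<times> F)) \<subseteq> (\<Union>j\<le>i. w ` Z j)"
    using stay by (fastforce simp: ops_boundary_def)
  moreover have finZ: "finite (Z j)" for j using fin by (auto simp: Z_def)
  ultimately have "card (ops_boundary i (w ` (P \<times> F))) \<le> card (\<Union>j\<le>i. w ` Z j)"
    by (intro card_mono) auto
  also have "\<dots> \<le> (\<Sum>j\<le>i. card (w ` Z j))" by (rule card_UN_le) simp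
  also have "\<dots> \<le> (\<Sum>j\<le>i. card (Z j))" using finZ by (intro sum_mono card_image_le) simp
  finally have "card (ops_boundary i (w ` (P \<times> F))) * M \<le> (\<Sum>j\<le>i. card (Z j) * M)"
    by (simp flip: sum_distrib_right)
  also have "\<dots> \<le> (\<Sum>j\<le>i. card P * card F)" using Z by (intro sum_mono) simp
  finally have "card (ops_boundary i (w ` (P \<times> F))) * M \<le> Suc i * card (w ` (P \<times> F))"
    using inj by (simp add: card_image card_cartesian_product)
  moreover have "card (w ` (P \<times> F)) = M ^ i * M ^ (M ^ i)"
    using inj card by (simp add: card_image card_cartesian_product)
  moreover have "w ` (P \<times> F) \<subseteq> lists (letters i) - {[]}"
    using set_config_word[of ls i a ps] ls by (fastforce simp: w_def)
  ultimately show ?thesis using fin by (intro exI[of _ "w ` (P \<times> F)"]) simp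
qed

section \<open>The transducer\<close>

datatype control = Start | Fwd bool | Bwd "scan list" | Cpy | Acc | Rej

instance control :: countable
  by countable_datatype

text \<open>
  The machine copies the input to the output tapes while moving right, and marks cell \<open>0\<close> of the input tape
  in order to recognise it on the way back.
\<close>

fun transition :: "nat \<Rightarrow> control \<Rightarrow> sym list \<Rightarrow> control \<times> move \<times> sym list" where
  "transition k Start as =
     (if hd as = Blank then (Rej, MoveL, as)
      else (Fwd (hd as = Live), MoveR, Mark # replicate k (hd as)))"
| "transition k (Fwd live) as =
     (if hd as \<noteq> Blank then (Fwd live, MoveR, replicate (Suc k) (hd as))
      else if live then (Bwd (map scan_init [0..<k]), MoveL, as)
      else (Cpy, MoveL, Blank # map Dead [0..<k]))"
| "transition k (Bwd sts) as =
     (if hd as = Mark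
      then (Acc, MoveL, Mark # map (\<lambda>j. if succeeds (sts ! j) then Live else Dead j) [0..<k])
      else (Bwd (map (\<lambda>j. scan_step j (sts ! j) (hd as)) [0..<k]), MoveL,
            hd as # map (\<lambda>j. scan_out j (sts ! j) (hd as)) [0..<k]))"
| "transition k Cpy as = (if hd as = Mark then Acc else Cpy, MoveL, as)"
| "transition k q as = (q, Stay, as)"

definition controls :: "nat \<Rightarrow> control set" where
  "controls k = {Start, Cpy, Acc, Rej} \<union> range Fwd \<union> Bwd ` {sts. length sts = k}"

text \<open>All tapes receive the same move \<open>d\<close>, so the heads are synchronous by
  construction.\<close>

definition machine :: "nat \<Rightarrow> (nat, nat) transducer" where
  "machine i = \<lparr>
     states = to_nat ` controls (Suc i),
     input_alphabet = to_nat ` letters i,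
     tape_alphabet = to_nat ` insert Blank (insert Mark (letters i)),
     blank = to_nat Blank,
     num_outputs = Suc i,
     start = to_nat Start,
     final = to_nat ` {Acc, Rej},
     accepting = {to_nat Acc},
     delta = (\<lambda>q as. case transition (Suc i) (from_nat q) (map from_nat as) of
       (q', d, as') \<Rightarrow> (to_nat q', map (\<lambda>a. (to_nat a, d)) as'))\<rparr>"

lemma machine_simps [simp]:
  "num_outputs (machine i) = Suc i" "blank (machine i) = to_nat Blank"
  "start (machine i) = to_nat Start" "final (machine i) = to_nat ` {Acc, Rej}"
  "accepting (machine i) = {to_nat Acc}" "input_alphabet (machine i) = to_nat ` letters i"
  by (simp_all add: machine_def)

lemma transition_closed:
  assumes "q \<in> controls k" "length as = Suc k" "set as \<subseteq> insert Blank (insert Mark (letters i))"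
    and "k = Suc i" "transition k q as = (q', d, as')"
  shows "q' \<in> controls k" "length as' = Suc k" "set as' \<subseteq> insert Blank (insert Mark (letters i))"
proof -
  define A where "A = insert Blank (insert Mark (letters i))"
  have A: "Blank \<in> A" "Mark \<in> A" "Live \<in> A" "j \<le> i \<Longrightarrow> Dead j \<in> A" for j
    by (simp_all add: A_def)
  obtain a bs where as: "as = a # bs" using assms(2) by (cases as) auto
  have out: "scan_out j (sts ! j) a \<in> A" for j sts
    using assms(3) as by (cases "sts ! j"; cases a) (auto simp: A_def)
  have "j \<le> i" if "j < k" for j using that assms(4) by simp
  with assms(1,2,5) assms(3)[folded A_def] as out A
  have "q' \<in> controls k \<and> length as' = Suc k \<and> set as' \<subseteq> A"
    by (cases q) (auto simp: controls_def split: if_splits)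
  then show "q' \<in> controls k" "length as' = Suc k" "set as' \<subseteq> insert Blank (insert Mark (letters i))"
    by (auto simp: A_def)
qed

lemma is_transducer_machine: "is_transducer (machine i)"
proof -
  let ?M = "machine i" and ?A = "insert Blank (insert Mark (letters i))"
  have "finite {sts :: scan list. length sts = Suc i}"
    using finite_lists_length_eq[of "UNIV :: scan set" "Suc i"] by simp
  then have fin: "finite (states ?M)" "finite (tape_alphabet ?M)"
    unfolding machine_def controls_def
    by (auto simp: finite_letters)
  have "q' \<in> states ?M \<and> length acts = num_outputs ?M + 1 \<and> fst ` set acts \<subseteq> tape_alphabet ?M"
    if "q \<in> states ?M - final ?M" "length as = num_outputs ?M + 1"
      "set as \<subseteq> tape_alphabet ?M" "delta ?M q as = (q', acts)" for q as q' acts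
  proof -
    obtain p d bs where p: "transition (Suc i) (from_nat q) (map from_nat as) = (p, d, bs)"
      by (metis prod_cases3)
    have "set (map from_nat as :: sym list) \<subseteq> ?A" "from_nat q \<in> controls (Suc i)"
      using that(1,3) by (auto simp: machine_def)
    note transition_closed[OF this(2) _ this(1) refl p]
    moreover have "q' = to_nat p" "acts = map (\<lambda>a. (to_nat a, d)) bs"
      using that(4) p by (simp_all add: machine_def)
    ultimately show ?thesis using that(2) by (auto simp: machine_def)
  qed
  moreover have "1 \<le> num_outputs ?M" "blank ?M \<in> tape_alphabet ?M"
    "input_alphabet ?M \<subseteq> tape_alphabet ?M - {blank ?M}" "start ?M \<in> states ?M"
    "final ?M \<subseteq> states ?M" "accepting ?M \<subseteq> final ?M"
    by (auto simp: machine_def controls_def)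
  ultimately show ?thesis unfolding is_transducer_def using fin by blast
qed

section \<open>Configurations and runs of the machine\<close>

definition conf :: "control \<Rightarrow> nat \<Rightarrow> sym list list \<Rightarrow> (nat, nat) config" where
  "conf q h vs = (to_nat q, map (\<lambda>v. (word_tape (to_nat Blank) (map to_nat v), h)) vs)"

definition sym_at :: "nat \<Rightarrow> sym list \<Rightarrow> sym" where
  "sym_at h v = (if h < length v then v ! h else Blank)"

text \<open>Writing a nonblank on the first cell behind the word lengthens it, so tapes remain
  describable by words.\<close>

definition put_at :: "nat \<Rightarrow> sym list \<Rightarrow> sym \<Rightarrow> sym list" where
  "put_at h v a = (if h < length v then v[h := a] else if a = Blank then v else v @ [a])"

lemma word_tape_put_at:
  assumes "h \<le> length v"
  shows "(word_tape (to_nat Blank) (map to_nat v))(h := to_nat a) =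
    word_tape (to_nat Blank) (map to_nat (put_at h v a))"
  using assms by (auto simp: word_tape_def put_at_def fun_eq_iff nth_append nth_list_update)

lemma step_conf:
  assumes "transition (Suc i) q (map (sym_at h) vs) = (q', d, as)" "\<forall>v\<in>set vs. h \<le> length v"
  shows "step (machine i) (conf q h vs) = conf q' (move_head d h) (map2 (put_at h) vs as)"
proof -
  let ?tape = "\<lambda>v. word_tape (to_nat Blank) (map to_nat v)"
  have "from_nat (?tape v h) = sym_at h v" for v
    by (simp add: word_tape_def sym_at_def)
  with assms(1) have "delta (machine i) (to_nat q) (map (\<lambda>(t, h). t h) (map (\<lambda>v. (?tape v, h)) vs)) =
      (to_nat q', map (\<lambda>a. (to_nat a, d)) as)"
    by (simp add: machine_def comp_def)
  moreover have "map2 (\<lambda>(t, h) (a, d). (t(h := a), move_head d h)) (map (\<lambda>v. (?tape v, h)) vs)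
      (map (\<lambda>a. (to_nat a, d)) as) = map (\<lambda>v. (?tape v, move_head d h)) (map2 (put_at h) vs as)"
    using assms(2) by (induction vs as rule: list_induct2') (auto simp: word_tape_put_at)
  ultimately show ?thesis unfolding step_def conf_def Let_def prod.case by simp
qed

lemma sym_at_simps [simp]:
  "sym_at 0 (y # v) = y" "sym_at (Suc h) (y # v) = sym_at h v" "sym_at h [] = Blank"
  "sym_at (length v) (v @ s) = sym_at 0 s" "sym_at (length v) v = Blank" "h < length v \<Longrightarrow> sym_at h v = v ! h"
  by (simp_all add: sym_at_def nth_append)

lemma put_at_simps [simp]:
  "put_at 0 (y # v) a = a # v" "put_at (Suc h) (y # v) a = y # put_at h v a"
  "put_at (length v) (v @ s) a = v @ put_at 0 s a"
  "put_at (length v) v a = (if a = Blank then v else v @ [a])"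
  "h \<le> length v \<Longrightarrow> put_at h v (sym_at h v) = v"
  "h < length v \<Longrightarrow> put_at h v (v ! h) = v"
  by (auto simp: put_at_def sym_at_def list_update_append)

lemma map2_map_same: "map2 f (map g xs) (map h xs) = map (\<lambda>x. f (g x) (h x)) xs"
  by (induction xs) auto

lemma map2_replicate: "map2 f (replicate n x) (replicate n y) = replicate n (f x y)"
  by (induction n) auto

definition run :: "nat \<Rightarrow> sym list \<Rightarrow> nat \<Rightarrow> (nat, nat) config" where
  "run i w = config_at (machine i) (map to_nat w)"

lemma run_Suc: "run i w (Suc t) = step (machine i) (run i w t)"
  by (simp add: run_def config_at_def)

lemma run_0: "run i w 0 = conf Start 0 (w # replicate (Suc i) [])"
  by (simp add: run_def config_at_def init_config_def conf_def word_tape_def map_replicate_const)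

context
  fixes i :: nat and y :: sym and u :: "sym list"
  assumes y: "y \<in> letters i" and u: "set u \<subseteq> letters i"
begin

lemma run_forward:
  "t \<le> length u \<Longrightarrow> run i (y # u) (Suc t) =
     conf (Fwd (y = Live)) (Suc t) ((Mark # u) # replicate (Suc i) (y # take t u))"
proof (induction t)
  case 0
  have "y \<noteq> Blank" using y by auto
  then show ?case
    unfolding run_Suc[of i _ 0] run_0 by (subst step_conf) (auto simp: map2_replicate put_at_def simp del: replicate_Suc)
next
  case (Suc t)
  then have "u ! t \<in> letters i" using u by (meson Suc_le_lessD nth_mem subsetD)
  then have "u ! t \<noteq> Blank" by auto
  with Suc have "put_at t (take t u) (u ! t) = take (Suc t) u"
    by (auto simp: put_at_def take_Suc_conv_app_nth)
  with Suc \<open>u ! t \<noteq> Blank\<close> show ?case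
    unfolding run_Suc[of i _ "Suc t"] Suc.IH[OF Suc_leD[OF Suc.prems]]
    by (subst step_conf) (auto simp: map2_replicate simp del: replicate_Suc, simp add: map2_replicate)
qed

text \<open>The heads turn on the first blank cell behind the input; for a dead word
  \<open>Dead j\<close> is written in that very cell.\<close>

lemma run_turn:
  "run i (y # u) (Suc (Suc (length u))) =
     (if y = Live
      then conf (Bwd (map scan_init [0..<Suc i])) (length u) ((Mark # u) # map (\<lambda>j. y # u) [0..<Suc i])
      else conf Cpy (length u) ((Mark # u) # map (\<lambda>j. y # u @ [Dead j]) [0..<Suc i]))"
proof -
  have "replicate (Suc i) v = map (\<lambda>_. v) [0..<Suc i]" for v :: "sym list"
    by (simp add: map_replicate_const)
  note rw = run_Suc[of i _ "Suc (length u)"] run_forward[OF le_refl] this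
  show ?thesis
  proof (cases "y = Live")
    case True
    then show ?thesis unfolding rw
      by (subst step_conf) (auto simp: map2_map_same comp_def simp del: upt_Suc)
  next
    case False
    then show ?thesis unfolding rw
      by (subst step_conf) (auto simp: map2_map_same comp_def simp del: upt_Suc)
  qed
qed

text \<open>\<open>suf\<close> has been scanned, while \<open>pre\<close> is still a plain copy; the
  head is on the last cell before \<open>suf\<close>.\<close>

lemma run_scan:
  assumes "y = Live" "u = pre @ suf"
  shows "run i (y # u) (Suc (Suc (length u)) + length suf) =
     conf (Bwd (map (\<lambda>j. scan j (scan_init j) (rev suf)) [0..<Suc i])) (length pre)
       ((Mark # u) # map (\<lambda>j. y # pre @ rev (scan_outs j (scan_init j) (rev suf))) [0..<Suc i])"
  using assms(2)
proof (induction suf arbitrary: pre)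
  case Nil
  then show ?case using run_turn assms(1) by simp
next
  case (Cons a suf)
  then have IH: "run i (y # u) (Suc (Suc (length u)) + length suf) =
     conf (Bwd (map (\<lambda>j. scan j (scan_init j) (rev suf)) [0..<Suc i])) (Suc (length pre))
       ((Mark # u) # map (\<lambda>j. y # pre @ a # rev (scan_outs j (scan_init j) (rev suf))) [0..<Suc i])"
    using Cons.IH[of "pre @ [a]"] by simp
  have "a \<noteq> Mark" using Cons.prems u by auto
  then have "transition (Suc i) (Bwd (map (\<lambda>j. scan j (scan_init j) (rev suf)) [0..<Suc i]))
      (map (sym_at (Suc (length pre))) ((Mark # u) # map (\<lambda>j. y # pre @ a # rev (scan_outs j (scan_init j) (rev suf))) [0..<Suc i]))
    = (Bwd (map (\<lambda>j. scan j (scan_init j) (rev (a # suf))) [0..<Suc i]), MoveL,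
       a # map (\<lambda>j. scan_out j (scan j (scan_init j) (rev suf)) a) [0..<Suc i])"
    using Cons.prems by (simp del: upt_Suc)
  then have "step (machine i) (run i (y # u) (Suc (Suc (length u)) + length suf)) =
    conf (Bwd (map (\<lambda>j. scan j (scan_init j) (rev (a # suf))) [0..<Suc i])) (length pre)
       ((Mark # u) # map (\<lambda>j. y # pre @ rev (scan_outs j (scan_init j) (rev (a # suf)))) [0..<Suc i])"
    unfolding IH by (subst step_conf) (use Cons.prems in \<open>auto simp: map2_map_same simp del: upt_Suc\<close>)
  then show ?case using run_Suc[of i "y # u" "Suc (Suc (length u)) + length suf"] by simp
qed

lemma run_copy:
  assumes "y \<noteq> Live" "r \<le> length u"
  shows "run i (y # u) (Suc (Suc (length u)) + r) =
     conf Cpy (length u - r) ((Mark # u) # map (\<lambda>j. y # u @ [Dead j]) [0..<Suc i])"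
  using assms(2)
proof (induction r)
  case 0
  then show ?case using run_turn assms(1) by simp
next
  case (Suc r)
  define h where "h = length u - Suc r"
  with Suc.prems have h: "length u - r = Suc h" "h < length u" "length u - Suc r = h" by auto
  have "u ! h \<noteq> Mark" using h u by (metis letters_iff(6) nth_mem subsetD)
  have "run i (y # u) (Suc (Suc (length u)) + Suc r) =
    step (machine i) (conf Cpy (Suc h) ((Mark # u) # map (\<lambda>j. y # u @ [Dead j]) [0..<Suc i]))"
    using Suc h run_Suc[of i "y # u" "Suc (Suc (length u)) + r"] by simp
  also have "\<dots> = conf Cpy h ((Mark # u) # map (\<lambda>j. y # u @ [Dead j]) [0..<Suc i])"
    by (subst step_conf)
      (use h \<open>u ! h \<noteq> Mark\<close> in \<open>auto simp: map2_map_same comp_def simp del: upt_Suc\<close>)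
  finally show ?case using h by simp
qed

text \<open>The last step is performed at cell 0, where a left move keeps the heads in place; on a
  live word it also writes the verdict as first letter.\<close>

lemma run_halt:
  "run i (y # u) (2 * length (y # u) + 1) =
     conf Acc 0 ((Mark # u) # map (\<lambda>j. opr j (y # u)) [0..<Suc i])"
proof (cases "y = Live")
  case True
  have "run i (y # u) (2 * length (y # u) + 1) =
      step (machine i) (run i (y # u) (Suc (Suc (length u)) + length u))"
    using run_Suc[of i "y # u" "Suc (Suc (length u)) + length u"] by (simp add: mult_2)
  also have "\<dots> = conf Acc 0 ((Mark # u) # map (\<lambda>j. opr j (y # u)) [0..<Suc i])"
  proof -
    let ?ws = "(Mark # u) # map (\<lambda>j. y # [] @ rev (scan_outs j (scan_init j) (rev u))) [0..<Suc i]"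
    have tr: "transition (Suc i) (Bwd (map (\<lambda>j. scan j (scan_init j) (rev u)) [0..<Suc i]))
        (map (sym_at (length [])) ?ws) =
      (Acc, MoveL, Mark # map (\<lambda>j. if ok j (rev u) then Live else Dead j) [0..<Suc i])"
      by (simp add: ok_def del: upt_Suc)
    show ?thesis
      unfolding run_scan[OF True append_Nil[symmetric]]
      by (subst step_conf[OF tr]) (auto simp: map2_map_same opr_def act_def True simp del: upt_Suc)
  qed
  finally show ?thesis .
next
  case False
  have "run i (y # u) (2 * length (y # u) + 1) =
      step (machine i) (run i (y # u) (Suc (Suc (length u)) + length u))"
    using run_Suc[of i "y # u" "Suc (Suc (length u)) + length u"] by (simp add: mult_2)
  also have "\<dots> = conf Acc 0 ((Mark # u) # map (\<lambda>j. opr j (y # u)) [0..<Suc i])"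
    unfolding run_copy[OF False le_refl]
    by (subst step_conf) (auto simp: map2_map_same comp_def opr_def False simp del: upt_Suc)
  finally show ?thesis .
qed

lemma run_heads:
  assumes "t \<le> 2 * length (y # u)"
  shows "\<exists>q vs. q \<notin> {Acc, Rej} \<and> run i (y # u) t =
    conf q (if t \<le> length (y # u) then t else 2 * length (y # u) - t) vs"
proof -
  consider "t = 0" | s where "t = Suc s" "s \<le> length u" | r where "t = Suc (Suc (length u)) + r" "r \<le> length u"
  proof (cases "t \<le> Suc (length u)")
    case True
    then show ?thesis using that(1,2) by (cases t) auto
  next
    case False
    then have "t = Suc (Suc (length u)) + (t - Suc (Suc (length u)))" by simp
    with assms show ?thesis using that(3)[of "t - Suc (Suc (length u))"] by simp
  qed
  then show ?thesis
  proof cases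
    case 1
    then show ?thesis by (auto simp: run_0 simp del: replicate_Suc)
  next
    case 2
    then show ?thesis using run_forward by fastforce
  next
    case 3
    have h: "(if t \<le> length (y # u) then t else 2 * length (y # u) - t) = length u - r"
      using 3 by simp
    show ?thesis
    proof (cases "y = Live")
      case True
      have e: "u = take (length u - r) u @ drop (length u - r) u" by simp
      have l: "length (take (length u - r) u) = length u - r" "length (drop (length u - r) u) = r"
        using 3 by simp_all
      show ?thesis unfolding h using run_scan[OF True e] unfolding l 3(1) by blast
    next
      case False
      show ?thesis unfolding h using run_copy[OF False 3(2)] unfolding 3(1) by blast
    qed
  qed
qed

end

section \<open>Halting, language and translation\<close>

lemma halts_at_machine:
  assumes "w \<in> lists (letters i)" "w \<noteq> []"
  shows "halts_at (machine i) (map to_nat w) N \<longleftrightarrow> N = 2 * length w + 1"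
proof -
  obtain y u where w: "w = y # u" "y \<in> letters i" "set u \<subseteq> letters i"
    using assms by (cases w) (auto simp: subset_iff)
  have late: "fst (run i w (2 * length w + 1)) \<in> final (machine i)"
    using run_halt[OF w(2,3)] by (simp add: w(1) conf_def)
  have early: "fst (run i w t) \<notin> final (machine i)" if "t < 2 * length w + 1" for t
    using run_heads[OF w(2,3), of t] that unfolding w(1) by (auto simp: conf_def)
  show ?thesis
  proof
    assume "halts_at (machine i) (map to_nat w) N"
    then have N: "fst (run i w N) \<in> final (machine i)" "\<forall>t<N. fst (run i w t) \<notin> final (machine i)"
      by (auto simp: halts_at_def run_def)
    then show "N = 2 * length w + 1"
      using early[of N] late by (metis linorder_neqE_nat)
  qed (use late early in \<open>simp add: halts_at_def run_def\<close>)
qed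

lemma lists_to_nat: "x \<in> lists (to_nat ` A) \<longleftrightarrow> (\<exists>w\<in>lists A. x = map to_nat w)"
  by (simp add: lists_image image_iff)

lemma halts_at_empty: "halts_at (machine i) [] 1" "run i [] 1 = conf Rej 0 (replicate (Suc (Suc i)) [])"
proof -
  have 0: "run i [] 0 = conf Start 0 (replicate (Suc (Suc i)) [])"
    by (simp add: run_0)
  show 1: "run i [] 1 = conf Rej 0 (replicate (Suc (Suc i)) [])"
    unfolding One_nat_def run_Suc 0
    by (subst step_conf[where q' = Rej and d = MoveL and as = "replicate (Suc (Suc i)) Blank"])
      (auto simp: map2_replicate put_at_def)
  then show "halts_at (machine i) [] 1"
    using 0 by (auto simp: halts_at_def run_def conf_def)
qed

lemma language_machine: "language (machine i) = map to_nat ` (lists (letters i) - {[]})"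
proof -
  have "(\<exists>N. halts_at (machine i) (map to_nat w) N \<and>
      fst (config_at (machine i) (map to_nat w) N) \<in> accepting (machine i)) \<longleftrightarrow> w \<noteq> []"
    if "w \<in> lists (letters i)" for w
  proof (cases w)
    case Nil
    have "N = 1" if "halts_at (machine i) [] N" for N
      using that halts_at_empty(1)[of i] by (metis halts_at_def linorder_neqE_nat)
    with Nil halts_at_empty(2)[of i] show ?thesis by (auto simp: run_def conf_def)
  next
    case (Cons y u)
    then have "y \<in> letters i" "set u \<subseteq> letters i" using that by auto
    from run_halt[OF this] show ?thesis
      using halts_at_machine[OF that] Cons by (auto simp: run_def conf_def)
  qed
  then show ?thesis unfolding language_def by (auto simp: lists_to_nat)
qed

text \<open>A blank-free word occupies exactly the nonblank cells, which recovers its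
  length.\<close>

lemma word_tape_inject:
  assumes "b \<notin> set v" "b \<notin> set w" "word_tape b v = word_tape b w"
  shows "v = w"
proof -
  have set: "{j. word_tape b v j \<noteq> b} = {..<length v}" if "b \<notin> set v" for v
    using that by (auto simp: word_tape_def in_set_conv_nth)
  have "length v = length w" using set[OF assms(1)] set[OF assms(2)] assms(3) by (metis card_lessThan)
  moreover have "v ! j = w ! j" if "j < length v" for j
    using fun_cong[OF assms(3), of j] that calculation by (simp add: word_tape_def)
  ultimately show ?thesis by (rule nth_equalityI) simp
qed

lemma opr_closed: "w \<in> lists (letters i) - {[]} \<Longrightarrow> j \<le> i \<Longrightarrow> opr j w \<in> lists (letters i) - {[]}"
proof -
  assume w: "w \<in> lists (letters i) - {[]}" and j: "j \<le> i"
  have closed: "set (scan_outs j st s) \<subseteq> letters i" if "set s \<subseteq> letters i" for s st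
    using that
  proof (induction s arbitrary: st)
    case (Cons y s)
    then have "scan_out j st y \<in> letters i" by (cases st; cases y) auto
    with Cons show ?case by auto
  qed simp
  have "set (rev (tl w)) \<subseteq> letters i" using w by (cases w) auto
  from closed[OF this] have "set (act j (rev (tl w))) \<subseteq> letters i" by (simp add: act_def)
  with w j show ?thesis by (auto simp: opr_def)
qed

lemma translates_machine:
  assumes "w \<in> lists (letters i) - {[]}"
  shows "translates (machine i) (map to_nat w) ys \<longleftrightarrow> ys = map (\<lambda>j. map to_nat (opr j w)) [0..<Suc i]"
proof -
  obtain y u where w: "w = y # u" "y \<in> letters i" "set u \<subseteq> letters i"
    using assms by (cases w) (auto simp: subset_iff)
  have tape: "fst (snd (config_at (machine i) (map to_nat w) (2 * length w + 1)) ! Suc j) =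
      word_tape (to_nat Blank) (map to_nat (opr j w))" if "j < Suc i" for j
    using run_halt[OF w(2,3)] that unfolding w(1)
    by (simp add: run_def conf_def nth_append del: upt_Suc)
  have out: "opr j w \<in> lists (letters i)" if "j < Suc i" for j
    using opr_closed[OF assms, of j] that by simp
  have out': "x \<in> letters i" if "x \<in> set (opr j w)" "j < Suc i" for x j
    using out[OF that(2)] that(1) by (simp add: in_lists_conv_set)
  have no_blank: "to_nat Blank \<notin> set v" if "v \<in> lists (to_nat ` letters i)" for v
    using that by (auto simp: in_lists_conv_set)
  have "translates (machine i) (map to_nat w) ys \<longleftrightarrow>
    length ys = Suc i \<and> set ys \<subseteq> lists (to_nat ` letters i) \<and>
    (\<forall>j<Suc i. word_tape (to_nat Blank) (map to_nat (opr j w)) = word_tape (to_nat Blank) (ys ! j))"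
    using assms halts_at_machine[of w i] tape
    by (auto simp: translates_def language_machine simp del: map_map)
  also have "\<dots> \<longleftrightarrow> ys = map (\<lambda>j. map to_nat (opr j w)) [0..<Suc i]"
  proof
    assume *: "length ys = Suc i \<and> set ys \<subseteq> lists (to_nat ` letters i) \<and>
      (\<forall>j<Suc i. word_tape (to_nat Blank) (map to_nat (opr j w)) = word_tape (to_nat Blank) (ys ! j))"
    show "ys = map (\<lambda>j. map to_nat (opr j w)) [0..<Suc i]"
    proof (rule nth_equalityI)
      fix j assume "j < length ys"
      then have j: "j < Suc i" "ys ! j \<in> set ys" using * by auto
      have "map to_nat (opr j w) = ys ! j"
      proof (rule word_tape_inject)
        show "to_nat Blank \<notin> set (map to_nat (opr j w))"
          using out[OF j(1)] by (intro no_blank) (auto simp: lists_to_nat)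
        show "to_nat Blank \<notin> set (ys ! j)" using * j(2) by (intro no_blank) auto
      qed (use * j in auto)
      then show "ys ! j = map (\<lambda>j. map to_nat (opr j w)) [0..<Suc i] ! j" using j(1) by (simp del: upt_Suc)
    qed (use * in simp)
  next
    assume "ys = map (\<lambda>j. map to_nat (opr j w)) [0..<Suc i]"
    then show "length ys = Suc i \<and> set ys \<subseteq> lists (to_nat ` letters i) \<and>
      (\<forall>j<Suc i. word_tape (to_nat Blank) (map to_nat (opr j w)) = word_tape (to_nat Blank) (ys ! j))"
      using out' by (auto simp del: upt_Suc)
  qed
  finally show ?thesis .
qed

lemma sweeps_machine:
  assumes "x \<in> lists (input_alphabet (machine i))"
  shows "sweeps (machine i) 0 x"
proof -
  obtain w where w: "w \<in> lists (letters i)" "x = map to_nat w"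
    using assms by (auto simp: lists_to_nat)
  show ?thesis
  proof (cases w)
    case Nil
    have "\<forall>t\<le>1. \<forall>(tape, h) \<in> set (snd (run i [] t)). h = 0"
      using halts_at_empty(2)[of i] run_0[of i "[]"]
      by (auto simp: le_Suc_eq conf_def)
    then show ?thesis
      using halts_at_empty(1)[of i] Nil w(2) unfolding sweeps_def run_def
      by (intro exI[of _ 0] exI[of _ "1::nat"]) (auto split: if_splits)
  next
    case (Cons y u)
    then have yu: "y \<in> letters i" "set u \<subseteq> letters i" using w(1) by auto
    have "\<forall>(tape, h) \<in> set (snd (run i w t)). h = (if t \<le> length w then t else 2 * length w - t)"
      if t: "t \<le> 2 * length w + 1" for t
    proof (cases "t \<le> 2 * length w")
      case True
      then show ?thesis using run_heads[OF yu, of t] unfolding Cons by (auto simp: conf_def)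
    next
      case False
      with t have "t = 2 * length w + 1" by simp
      then show ?thesis using run_halt[OF yu] unfolding Cons by (auto simp: conf_def)
    qed
    then show ?thesis
      using halts_at_machine[OF w(1)] Cons w(2) unfolding sweeps_def run_def
      by (intro exI[of _ "length w"] exI[of _ "2 * length w + 1"]) auto
  qed
qed

section \<open>Membership in the class, outputs and Folner sets\<close>

lemma machine_in_class_T: "machine i \<in> class_T"
proof -
  have "\<exists>ys. translates (machine i) x ys \<and> set ys \<subseteq> language (machine i)"
    if x: "x \<in> language (machine i)" for x
  proof -
    obtain w where w: "x = map to_nat w" "w \<in> lists (letters i) - {[]}"
      using x unfolding language_machine by blast
    have "map to_nat (opr j w) \<in> language (machine i)" if "j < Suc i" for j
      using opr_closed[OF w(2), of j] that by (auto simp: language_machine)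
    then show ?thesis
      unfolding w(1) translates_machine[OF w(2)] by (auto simp del: upt_Suc map_map)
  qed
  then show ?thesis
    unfolding class_T_def using is_transducer_machine sweeps_machine by blast
qed

lemma outputs_machine:
  assumes "w \<in> lists (letters i) - {[]}"
  shows "outputs (machine i) (map to_nat w) = (\<lambda>j. map to_nat (opr j w)) ` {..i}"
proof -
  have "outputs (machine i) (map to_nat w) = set (map (\<lambda>j. map to_nat (opr j w)) [0..<Suc i])"
    unfolding outputs_def translates_machine[OF assms] by blast
  also have "\<dots> = (\<lambda>j. map to_nat (opr j w)) ` {..i}"
    by (simp only: set_map set_upt atLeast0LessThan lessThan_Suc_atMost)
  finally show ?thesis .
qed

text \<open>The coding of letters is injective, so boundaries and cardinalities carry over.\<close>

lemma folner_sets_machine: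
  "folner_sets (machine i) \<epsilon> = (image (map to_nat)) `
     {W. finite W \<and> W \<subseteq> lists (letters i) - {[]} \<and> real (card (ops_boundary i W)) < \<epsilon> * real (card W)}"
proof -
  have inj: "inj_on (map to_nat) W" for W :: "sym list set"
    by (rule inj_on_subset[OF inj_mapI]) auto
  have "boundary (machine i) (map to_nat ` W) = map to_nat ` ops_boundary i W"
    if "W \<subseteq> lists (letters i) - {[]}" for W
  proof -
    have mem: "map to_nat v \<in> map to_nat ` W \<longleftrightarrow> v \<in> W" for v :: "sym list"
      by (rule inj_image_mem_iff[OF inj])
    have "outputs (machine i) (map to_nat w) = (\<lambda>j. map to_nat (opr j w)) ` {..i}" if "w \<in> W" for w
      using that \<open>W \<subseteq> _\<close> by (intro outputs_machine) auto
    then have "outputs (machine i) (map to_nat w) \<subseteq> map to_nat ` W \<longleftrightarrow> (\<forall>j\<le>i. opr j w \<in> W)"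
      if "w \<in> W" for w
      using that by (auto simp: image_subset_iff mem)
    then have "{w \<in> W. \<not> outputs (machine i) (map to_nat w) \<subseteq> map to_nat ` W} = ops_boundary i W"
      unfolding ops_boundary_def by blast
    then show ?thesis unfolding boundary_def by blast
  qed
  then have mem: "map to_nat ` W \<in> folner_sets (machine i) \<epsilon> \<longleftrightarrow>
      finite W \<and> real (card (ops_boundary i W)) < \<epsilon> * real (card W)"
    if "W \<subseteq> lists (letters i) - {[]}" for W
    using that image_mono[OF that, of "map to_nat"]
    by (simp add: folner_sets_def language_machine card_image[OF inj] finite_image_iff[OF inj])
  have ex: "\<exists>W0. W0 \<subseteq> lists (letters i) - {[]} \<and> W = map to_nat ` W0"
    if "W \<in> folner_sets (machine i) \<epsilon>" for W
    using that by (auto simp: folner_sets_def language_machine subset_image_iff)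
  show ?thesis
  proof (intro equalityI subsetI)
    fix W assume W: "W \<in> folner_sets (machine i) \<epsilon>"
    then obtain W0 where W0: "W0 \<subseteq> lists (letters i) - {[]}" "W = map to_nat ` W0" using ex by blast
    with W mem[OF W0(1)] show "W \<in> (image (map to_nat)) ` {W. finite W \<and> W \<subseteq> lists (letters i) - {[]} \<and>
        real (card (ops_boundary i W)) < \<epsilon> * real (card W)}"
      by blast
  next
    fix W assume "W \<in> (image (map to_nat)) ` {W. finite W \<and> W \<subseteq> lists (letters i) - {[]} \<and>
        real (card (ops_boundary i W)) < \<epsilon> * real (card W)}"
    then obtain W0 where "W0 \<subseteq> lists (letters i) - {[]}" "W = map to_nat ` W0"
      "finite W0" "real (card (ops_boundary i W0)) < \<epsilon> * real (card W0)" by blast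
    with mem show "W \<in> folner_sets (machine i) \<epsilon>" by blast
  qed
qed

lemma folner_set_machine_le:
  assumes "1 \<le> n"
  shows "\<exists>W\<in>folner_sets (machine i) (1 / real n).
    card W \<le> ((2 * Suc i ^ 2 + 2) * n) ^ (((2 * Suc i ^ 2 + 2) * n) ^ i)"
proof -
  let ?K = "2 * Suc i ^ 2 + 2"
  \<comment> \<open>The side \<open>M\<close> is the power of two with (i + 1) * n < M \<le> 2 * (i
    + 1) * n: large enough for the boundary ratio, yet linear in \<open>n\<close>.\<close>
  obtain a where a: "2 ^ a \<le> Suc i * n" "Suc i * n < 2 ^ (a + 1)"
    using ex_power_ivl1[of 2 "Suc i * n"] assms by auto
  define M :: nat where "M = 2 ^ (a + 1)"
  obtain W where W: "finite W" "W \<subseteq> lists (letters i) - {[]}" "card W = M ^ i * M ^ (M ^ i)"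
      "card (ops_boundary i W) * M \<le> Suc i * card W"
    using ops_upper_bound[of i "a + 1"] unfolding M_def by blast
  have "0 < M" by (simp add: M_def)
  have "card (ops_boundary i W) * n < card W"
  proof (cases "ops_boundary i W = {}")
    case True
    then show ?thesis using W(3) \<open>0 < M\<close> by simp
  next
    case False
    then have "0 < card (ops_boundary i W)"
      using W(1) by (simp add: card_gt_0_iff ops_boundary_def)
    then have "card (ops_boundary i W) * (Suc i * n) < card (ops_boundary i W) * M"
      using a(2) by (simp add: M_def)
    then have "Suc i * (card (ops_boundary i W) * n) < Suc i * card W"
      using W(4) by (simp add: algebra_simps)
    then show ?thesis by (metis mult_less_cancel1)
  qed
  then have "real (card (ops_boundary i W) * n) < real (card W)" by (simp only: of_nat_less_iff)
  then have "real (card (ops_boundary i W)) < 1 / real n * real (card W)"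
    using assms by (simp add: field_simps)
  then have "map to_nat ` W \<in> folner_sets (machine i) (1 / real n)"
    using W(1,2) by (auto simp: folner_sets_machine)
  moreover have "card (map to_nat ` W) \<le> (?K * n) ^ ((?K * n) ^ i)"
  proof -
    have "Suc i * M \<le> ?K * n"
      using mult_le_mono2[of "M" "2 * (Suc i * n)" "Suc i"] a(1) by (simp add: M_def power2_eq_square algebra_simps)
    then have "M \<le> ?K * n" "(Suc i * M) ^ i \<le> (?K * n) ^ i"
      by (simp, intro power_mono) auto
    \<comment> \<open>The factor \<open>M ^ i\<close> counting positions adds \<open>i\<close> to
      the exponent; it is absorbed by enlarging the base \<open>M\<close> to
      \<open>Suc i * M\<close>.\<close>
    have "i + M ^ i \<le> (?K * n) ^ i"
    proof (cases "i = 0")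
      case False
      have "i + M ^ i \<le> Suc i * M ^ i" using \<open>0 < M\<close> by simp
      also have "\<dots> \<le> Suc i ^ i * M ^ i"
        using False by (intro mult_right_mono) (simp_all add: self_le_power del: power_Suc)
      also have "\<dots> = (Suc i * M) ^ i" by (simp only: power_mult_distrib)
      also note \<open>(Suc i * M) ^ i \<le> _\<close>
      finally show ?thesis .
    qed simp
    have "card (map to_nat ` W) \<le> card W" using W(1) by (rule card_image_le)
    also have "\<dots> = M ^ (i + M ^ i)" using W(3) by (simp add: power_add)
    also have "\<dots> \<le> (?K * n) ^ (i + M ^ i)" using \<open>M \<le> _\<close> by (intro power_mono) auto
    also have "\<dots> \<le> (?K * n) ^ ((?K * n) ^ i)"
      using \<open>i + M ^ i \<le> _\<close> assms by (intro power_increasing) auto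
    finally show ?thesis .
  qed
  ultimately show ?thesis by blast
qed

section \<open>Matching bounds for the Folner function\<close>

theorem theorem7:
  fixes i :: nat
  assumes "i \<ge> 1"
  shows "\<exists>T :: (nat, nat) transducer.
           T \<in> class_T \<and> folner_defined T \<and>
           growth_equiv (folner_function T) (\<lambda>n. n ^ (n ^ i))"
proof (intro exI conjI)
  let ?K = "2 * Suc i ^ 2 + 2"
  let ?f = "folner_function (machine i)"
  show "machine i \<in> class_T" by (rule machine_in_class_T)
  show "folner_defined (machine i)"
    unfolding folner_defined_def
  proof (intro allI impI)
    fix \<epsilon> :: real assume "0 < \<epsilon> \<and> \<epsilon> < 1"
    then obtain n where n: "1 / real (Suc n) < \<epsilon>"
      using reals_Archimedean by (auto simp: inverse_eq_divide)
    obtain W where W: "W \<in> folner_sets (machine i) (1 / real (Suc n))"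
      using folner_set_machine_le[of "Suc n" i] by auto
    moreover have "1 / real (Suc n) * real (card W) \<le> \<epsilon> * real (card W)"
      using n by (intro mult_right_mono) auto
    ultimately have "W \<in> folner_sets (machine i) \<epsilon>"
      by (auto simp: folner_sets_def)
    then show "folner_sets (machine i) \<epsilon> \<noteq> {}" by blast
  qed
  have upper: "?f n \<le> (?K * n) ^ ((?K * n) ^ i)" if n: "1 \<le> n" for n
  proof -
    obtain W where "W \<in> folner_sets (machine i) (1 / real n)" "card W \<le> (?K * n) ^ ((?K * n) ^ i)"
      using folner_set_machine_le[OF n] by blast
    then show ?thesis
      unfolding folner_function_def Fol_def by (intro order_trans[OF Least_le]) blast+
  qed
  have lower: "n ^ (n ^ i) \<le> ?f (?K * n)" if n: "1 \<le> n" for n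
  proof -
    have "1 \<le> ?K * n" using n by simp
    from folner_set_machine_le[OF this] obtain W where W: "W \<in> folner_sets (machine i) (1 / real (?K * n))"
      by blast
    \<comment> \<open>The minimum over a nonempty family is attained, so the lower bound can be
      applied to an actual set.\<close>
    have "\<exists>W\<in>folner_sets (machine i) (1 / real (?K * n)). ?f (?K * n) = card W"
      unfolding folner_function_def Fol_def
      by (rule LeastI[of "\<lambda>m. \<exists>W\<in>folner_sets (machine i) (1 / real (?K * n)). m = card W" "card W"])
        (use W in blast)
    then obtain V where V: "finite V" "V \<subseteq> lists (letters i) - {[]}"
        "real (card (ops_boundary i V)) < 1 / real (?K * n) * real (card V)"
        "?f (?K * n) = card (map to_nat ` V)"
      unfolding folner_sets_machine by blast
    have "real (card (ops_boundary i V)) * real (?K * n) < real (card V)"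
      using V(3) \<open>1 \<le> ?K * n\<close> by (simp add: pos_less_divide_eq del: of_nat_mult)
    then have "card (ops_boundary i V) * (?K * n) < card V"
      by (simp only: of_nat_mult[symmetric] of_nat_less_iff)
    then have "n ^ (n ^ i) \<le> card V"
      using V(1,2) assms n by (intro ops_lower_bound) auto
    moreover have "card (map to_nat ` V) = card V"
      by (intro card_image inj_on_subset[OF inj_mapI]) auto
    ultimately show ?thesis using V(4) by simp
  qed
  \<comment> \<open>The same constant \<open>?K\<close> serves both bounds, and the factor 1/K in
    the equivalence only weakens them.\<close>
  have weaken: "real b \<ge> 1 / real k * real a" if "a \<le> b" "1 \<le> k" for a b k :: nat
  proof -
    have "1 / real k * real a \<le> 1 * real a" using that(2) by (intro mult_right_mono) auto
    with that(1) show ?thesis by linarith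
  qed
  have "1 \<le> ?K" by simp
  with upper lower weaken show "growth_equiv ?f (\<lambda>n. n ^ (n ^ i))"
    unfolding growth_equiv_def by blast
qed

end
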